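(* Let $k$ be a non-Archimedean field (not necessarily complete) with valuation ring $\mathfrak{o}$ and residue field $\mathbb{F}$, and let $\phi \in k(z)$ be a rational function of degree at least $2$ (equivalently, a morphism $\mathbb{P}^1_k \to \mathbb{P}^1_k$ of degree at least $2$). Suppose that $\phi$ has good reduction. Then every element of $\underline{\mathrm{Aut}}_\phi(k)$ has good reduction, and the canonical reduction $\mathfrak{o} \to \mathbb{F}$ induces a homomorphism $\mathrm{red} : \underline{\mathrm{Aut}}_\phi(k) \to \underline{\mathrm{Aut}}_\phi(\mathbb{F})$. If $\mathbb{F}$ has characteristic $p > 0$ (resp. characteristic zero), then the kernel of $\mathrm{red}$ is a $p$-group (resp. trivial).
   Context: The degree of a rational function $f/g$ with $f,g$ coprime polynomials is $\max\{\deg f,\deg g\}$. An endomorphism $\phi:\mathbb{P}^1_k\to\mathbb{P}^1_k$ has good reduction if there exists a morphism $\Phi:\mathbb{P}^1_{\mathfrak{o}}\to\mathbb{P}^1_{\mathfrak{o}}$ that agrees with $\phi$ on the generic fiber; the reduction of $\phi$ is then the restriction of $\Phi$ to the special fiber $\mathbb{P}^1_{\mathbb{F}}$. This definition applies in particular to degree-one maps, i.e. elements of $\mathrm{PGL}_2(k)=\mathrm{Aut}(\mathbb{P}^1_k)$. For a morphism $\phi$ of the projective line over a ring $R$ and a commutative $R$-algebra $S$, $\underline{\mathrm{Aut}}_\phi(S) = \{f\in\mathrm{Aut}(\mathbb{P}^1_S) : f\circ\phi\circ f^{-1}=\phi\}$ (with $\phi$ base-changed to $S$). Thus $\underline{\mathrm{Aut}}_\phi(\mathbb{F})$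 is the group of $f\in\mathrm{PGL}_2(\mathbb{F})$ that commute with the reduction of $\phi$. *)

theory Defs
  imports
    "HOL-Algebra.Multiplicative_Group"
    "HOL-Computational_Algebra.Polynomial"
    "HOL-Computational_Algebra.Fraction_Field"
begin

section \<open>Non-Archimedean fields\<close>

definition nonarch_abs :: "('k::field \<Rightarrow> real) \<Rightarrow> bool" where
  "nonarch_abs v \<longleftrightarrow>
     (\<forall>x. v x \<ge> 0) \<and> (\<forall>x. v x = 0 \<longleftrightarrow> x = 0) \<and>
     (\<forall>x y. v (x * y) = v x * v y) \<and>
     (\<forall>x y. v (x + y) \<le> max (v x) (v y))"

definition val_ring :: "('k::field \<Rightarrow> real) \<Rightarrow> 'k set" where
  "val_ring v = {x. v x \<le> 1}"

text \<open>
  The residue field is given as a field \<open>'f\<close> together with a canonical reduction: a surjective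
  ring homomorphism from the valuation ring whose kernel is the maximal ideal. This determines
  \<open>'f\<close> up to unique isomorphism. The values of \<open>res\<close> outside the valuation ring are irrelevant.
\<close>

definition residue_map :: "('k::field \<Rightarrow> real) \<Rightarrow> ('k \<Rightarrow> 'f::field) \<Rightarrow> bool" where
  "residue_map v res \<longleftrightarrow>
     (\<forall>x\<in>val_ring v. \<forall>y\<in>val_ring v. res (x + y) = res x + res y) \<and>
     (\<forall>x\<in>val_ring v. \<forall>y\<in>val_ring v. res (x * y) = res x * res y) \<and>
     res 1 = 1 \<and>
     res ` val_ring v = UNIV \<and>
     (\<forall>x\<in>val_ring v. res x = 0 \<longleftrightarrow> v x < 1)"

section \<open>Endomorphisms of the projective line over a local ring\<close>

text \<open>
  Throughout, \<open>R\<close> is a subring of the ambient type; it is only ever instantiated with a field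
  (\<open>UNIV\<close>) or with the valuation ring, so it is always local.

  A binary form of degree \<open>d\<close> in \<open>X, Y\<close> is represented by its dehomogenization at \<open>Y = 1\<close>: the
  polynomial \<open>F\<close> with \<open>degree F \<le> d\<close> stands for the sum over \<open>i \<le> d\<close> of
  \<open>coeff F i * X ^ i * Y ^ (d - i)\<close>. The following function substitutes \<open>A\<close> for \<open>X\<close> and
  \<open>B\<close> for \<open>Y\<close>.
\<close>

definition form_subst ::
  "nat \<Rightarrow> 'a::comm_ring_1 poly \<Rightarrow> 'a poly \<Rightarrow> 'a poly \<Rightarrow> 'a poly" where
  "form_subst d F A B = (\<Sum>i\<le>d. smult (coeff F i) (A ^ i * B ^ (d - i)))"

definition poly_over :: "'a::comm_ring_1 set \<Rightarrow> 'a poly set" where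
  "poly_over R = {p. \<forall>i. coeff p i \<in> R}"

definition unit_ideal :: "'a::comm_ring_1 set \<Rightarrow> 'a poly \<Rightarrow> 'a poly \<Rightarrow> bool" where
  "unit_ideal R p q \<longleftrightarrow> (\<exists>a\<in>poly_over R. \<exists>b\<in>poly_over R. a * p + b * q = 1)"

text \<open>
  Since the Picard group of the projective line over a local ring is generated by \<open>O(1)\<close>, an
  \<open>R\<close>-morphism from the projective line to itself is given by a degree \<open>d\<close> and two sections
  \<open>F, G\<close> of \<open>O(d)\<close>, i.e. forms of degree \<open>d\<close> over \<open>R\<close>, that generate \<open>O(d)\<close>; these data are unique
  up to a common unit of \<open>R\<close>. Generation is tested on the two standard charts, where \<open>Y = 1\<close> and
  \<open>X = 1\<close> respectively. A morphism is accordingly an equivalence class of triples \<open>(d, F, G)\<close>.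
\<close>

definition P1_reps :: "'a::comm_ring_1 set \<Rightarrow> (nat \<times> 'a poly \<times> 'a poly) set" where
  "P1_reps R = {(d, F, G). F \<in> poly_over R \<and> G \<in> poly_over R \<and> degree F \<le> d \<and> degree G \<le> d \<and>
     unit_ideal R (form_subst d F [:0, 1:] 1) (form_subst d G [:0, 1:] 1) \<and>
     unit_ideal R (form_subst d F 1 [:0, 1:]) (form_subst d G 1 [:0, 1:])}"

definition P1_rel ::
  "'a::comm_ring_1 set \<Rightarrow> ((nat \<times> 'a poly \<times> 'a poly) \<times> (nat \<times> 'a poly \<times> 'a poly)) set" where
  "P1_rel R = {((d, F, G), (d, smult c F, smult c G)) | d F G c.
     (d, F, G) \<in> P1_reps R \<and> c \<in> R \<and> (\<exists>c'\<in>R. c * c' = 1)}"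

type_synonym 'a P1_mor = "(nat \<times> 'a poly \<times> 'a poly) set"

definition P1_comp :: "'a::comm_ring_1 set \<Rightarrow> 'a P1_mor \<Rightarrow> 'a P1_mor \<Rightarrow> 'a P1_mor" where
  "P1_comp R f g = P1_rel R ``
     {(d * e, form_subst d F A B, form_subst d G A B) | d F G e A B. (d, F, G) \<in> f \<and> (e, A, B) \<in> g}"

definition P1_End :: "'a::comm_ring_1 set \<Rightarrow> 'a P1_mor monoid" where
  "P1_End R = \<lparr>carrier = P1_reps R // P1_rel R, monoid.mult = P1_comp R,
     one = P1_rel R `` {(1, [:0, 1:], 1)}\<rparr>"

text \<open>Automorphisms of the projective line over \<open>R\<close> are the units of the monoid of endomorphisms.\<close>

definition P1_Aut :: "'a::comm_ring_1 set \<Rightarrow> 'a P1_mor \<Rightarrow> 'a P1_mor monoid" where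
  "P1_Aut R \<phi> = (units_of (P1_End R))
     \<lparr>carrier := {f \<in> Units (P1_End R).
        f \<otimes>\<^bsub>P1_End R\<^esub> \<phi> \<otimes>\<^bsub>P1_End R\<^esub> inv\<^bsub>P1_End R\<^esub> f = \<phi>}\<rparr>"

text \<open>Base change along a ring homomorphism \<open>h\<close> with target \<open>S\<close>.\<close>

definition P1_base_change ::
  "'b::comm_ring_1 set \<Rightarrow> ('a::comm_ring_1 \<Rightarrow> 'b) \<Rightarrow> 'a P1_mor \<Rightarrow> 'b P1_mor" where
  "P1_base_change S h f = P1_rel S `` {(d, map_poly h F, map_poly h G) | d F G. (d, F, G) \<in> f}"

section \<open>Rational functions\<close>

definition rat_degree :: "'k::field poly fract \<Rightarrow> nat" where
  "rat_degree \<phi> = (THE d. \<exists>f g. coprime f g \<and> g \<noteq> 0 \<and> \<phi> = Fract f g \<and> d = max (degree f) (degree g))"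

text \<open>
  The endomorphism of the projective line over \<open>'k\<close> defined by a rational function. The coprime
  representations of \<open>\<phi>\<close> differ by nonzero constants, so they form one class of \<open>P1_rel UNIV\<close>.
\<close>

definition rat_mor :: "'k::field poly fract \<Rightarrow> 'k P1_mor" where
  "rat_mor \<phi> = {(max (degree f) (degree g), f, g) | f g. coprime f g \<and> g \<noteq> 0 \<and> \<phi> = Fract f g}"

section \<open>Good reduction\<close>

definition good_model :: "('k::field \<Rightarrow> real) \<Rightarrow> 'k P1_mor \<Rightarrow> 'k P1_mor \<Rightarrow> bool" where
  "good_model v \<phi> \<Phi> \<longleftrightarrow> \<Phi> \<in> carrier (P1_End (val_ring v)) \<and> P1_base_change UNIV id \<Phi> = \<phi>"

definition good_reduction :: "('k::field \<Rightarrow> real) \<Rightarrow> 'k P1_mor \<Rightarrow> bool" where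
  "good_reduction v \<phi> \<longleftrightarrow> (\<exists>\<Phi>. good_model v \<phi> \<Phi>)"

text \<open>The model is unique if it exists, so the description below is meaningful.\<close>

definition reduction ::
  "('k::field \<Rightarrow> real) \<Rightarrow> ('k \<Rightarrow> 'f::field) \<Rightarrow> 'k P1_mor \<Rightarrow> 'f P1_mor" where
  "reduction v res \<phi> = P1_base_change UNIV res (THE \<Phi>. good_model v \<phi> \<Phi>)"

section \<open>p-groups\<close>

definition p_group :: "nat \<Rightarrow> ('a, 'b) monoid_scheme \<Rightarrow> bool" where
  "p_group p G \<longleftrightarrow> group G \<and> (\<forall>x\<in>carrier G. \<exists>n. group.ord G x = p ^ n)"

end

theory Submission
  imports Defs
begin

text \<open>
  Let \<open>\<Phi>\<close> be a pair of binary forms over the valuation ring that defines the given map, of degree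
  \<open>d \<ge> 2\<close>. A commuting automorphism is the class of an invertible matrix \<open>A\<close> over the field, and
  commuting means \<open>\<Phi> \<circ> A = c (A \<circ> \<Phi>)\<close> for some constant \<open>c\<close>.

  \<^bold>\<open>Automorphisms have good reduction.\<close> Good reduction of \<open>\<Phi>\<close> says that \<open>\<Phi>\<close>, as a self-map of the
  plane with the maximum norm, sends a vector of norm \<open>r\<close> to one of norm \<open>r^d\<close>
  (\<open>vec_norm_rep_eval\<close>). Evaluating the commutation at a coordinate vector where \<open>A\<close> attains its
  operator norm \<open>|A|\<close> gives \<open>|A|^d \<le> |c| |A|\<close> (\<open>rep_size_power_le\<close>). The inverse \<open>B\<close> of \<open>A\<close>
  satisfies the same equation with the inverse constant, so \<open>(|A| |B|)^d \<le> |A| |B|\<close> and hence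
  \<open>|A| |B| \<le> 1\<close>. The number \<open>|A|\<close> is a value of the absolute value, so after scaling both \<open>A\<close> and \<open>B\<close>
  have integral entries (\<open>good_reduction_Aut\<close>). Reduction of integral pairs of forms is compatible with composition, which yields the
  homomorphism.

  \<^bold>\<open>The kernel has no torsion prime to the residue characteristic.\<close> By the Cayley--Hamilton theorem
  \<open>A^m = s A + t\<close>. If \<open>A\<close> is congruent to a scalar matrix \<open>\<gamma>\<close>, then \<open>s\<close> is congruent to
  \<open>m \<gamma>^(m - 1)\<close>, so \<open>s \<noteq> 0\<close> when \<open>m\<close> is nonzero in the residue field; if moreover \<open>A^m\<close> is scalar,
  then \<open>s A\<close> is scalar and so is \<open>A\<close> (\<open>kernel_torsion_trivial\<close>).

  \<^bold>\<open>Elements of the kernel have finite order.\<close> Let \<open>x\<close> be the pair of coordinates. The determinants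
  \<open>P = det(\<Phi>, A x)\<close> and \<open>Q = det(\<Phi>, x)\<close> are forms of degree \<open>d + 1\<close> which substitution of \<open>A\<close>
  multiplies by one and the same constant. Hence a combination of \<open>P\<close> and \<open>Q\<close> that vanishes at
  a point vanishes on its orbit, and if the orbit is long it vanishes identically. Then \<open>det(\<Phi>, L) = 0\<close>
  for a pair \<open>L\<close> of linear forms, which forces \<open>L = 0\<close> because the components of \<open>\<Phi>\<close> are coprime
  of degree \<open>d \<ge> 2\<close>; so \<open>A\<close> is scalar (\<open>commuting_imp_finite_order\<close>). A suitable starting point exists over
  an infinite field. A finite field has only the trivial absolute value, for which reduction is
  injective.

  The last two facts combine to the statement on the kernel: if an element has order \<open>p^n q\<close> with
  \<open>q\<close> prime to \<open>p\<close>, its power with exponent \<open>p^n\<close> is trivial; in characteristic zero the element itself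
  is.
\<close>

section \<open>Binary forms and substitution\<close>

lemma smult_sum_right: "smult c (\<Sum>i\<in>I. f i) = (\<Sum>i\<in>I. smult c (f i))"
  by (induction I rule: infinite_finite_induct) (simp_all add: smult_add_right)

lemma form_subst_0 [simp]: "form_subst d 0 A B = 0"
  by (simp add: form_subst_def)

lemma form_subst_add: "form_subst d (p + q) A B = form_subst d p A B + form_subst d q A B"
  by (simp add: form_subst_def smult_add_left sum.distrib)

lemma form_subst_smult: "form_subst d (smult c p) A B = smult c (form_subst d p A B)"
  by (simp add: form_subst_def smult_sum_right)

lemma form_subst_sum: "form_subst d (\<Sum>i\<in>I. f i) A B = (\<Sum>i\<in>I. form_subst d (f i) A B)"
  by (induction I rule: infinite_finite_induct) (simp_all add: form_subst_add)

lemma form_subst_monom: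
  "i \<le> d \<Longrightarrow> form_subst d (monom c i) A B = smult c (A ^ i * B ^ (d - i))"
  by (simp add: form_subst_def if_distrib[of "\<lambda>c. smult c _"] cong: if_cong)

text \<open>The degrees with which polynomials are read as forms add up under multiplication, even when the
  true degrees are smaller. This multiplicativity replaces an explicit theory of binary forms.\<close>

lemma form_subst_mult:
  assumes "degree p \<le> m" "degree q \<le> n"
  shows "form_subst (m + n) (p * q) A B = form_subst m p A B * form_subst n q A B"
proof -
  have pq: "p * q = (\<Sum>i\<le>m. \<Sum>j\<le>n. monom (coeff p i * coeff q j) (i + j))"
    using sum_product[of "\<lambda>i. monom (coeff p i) i" "{..m}" "\<lambda>j. monom (coeff q j) j" "{..n}"]
    by (simp add: mult_monom poly_as_sum_of_monoms'[OF assms(1)] poly_as_sum_of_monoms'[OF assms(2)])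
  have "form_subst (m + n) (p * q) A B =
      (\<Sum>i\<le>m. \<Sum>j\<le>n. smult (coeff p i * coeff q j) (A ^ (i + j) * B ^ (m + n - (i + j))))"
    unfolding pq form_subst_sum by (intro sum.cong refl form_subst_monom) auto
  also have "\<dots> = (\<Sum>i\<le>m. \<Sum>j\<le>n.
      smult (coeff p i) (A ^ i * B ^ (m - i)) * smult (coeff q j) (A ^ j * B ^ (n - j)))"
  proof (intro sum.cong refl)
    fix i j assume ij: "i \<in> {..m}" "j \<in> {..n}"
    then have "m + n - (i + j) = (m - i) + (n - j)" by auto
    then show "smult (coeff p i * coeff q j) (A ^ (i + j) * B ^ (m + n - (i + j))) =
      smult (coeff p i) (A ^ i * B ^ (m - i)) * smult (coeff q j) (A ^ j * B ^ (n - j))"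
      by (simp add: power_add mult_ac)
  qed
  finally show ?thesis
    by (simp add: form_subst_def sum_product)
qed

lemma form_subst_1: "form_subst n 1 A B = B ^ n"
  using form_subst_monom[of 0 n 1 A B] by simp

lemma form_subst_X: "form_subst 1 [:0, 1:] A B = A"
  using form_subst_monom[of 1 1 1 A B] by (simp add: monom_altdef)

lemma form_subst_linear: "form_subst 1 p A B = smult (coeff p 0) B + smult (coeff p 1) A"
  by (simp add: form_subst_def)

lemma form_subst_power:
  assumes "degree p \<le> e"
  shows "form_subst (i * e) (p ^ i) A B = form_subst e p A B ^ i"
proof (induction i)
  case (Suc i)
  have "degree (p ^ i) \<le> i * e"
    using degree_power_le[of p i] assms by (metis le_trans mult.commute mult_le_mono1)
  then show ?case
    using form_subst_mult[OF assms, of "p ^ i" "i * e"] Suc by (simp add: mult.commute)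
qed (simp add: form_subst_1)

lemma degree_form_subst:
  assumes "degree A \<le> e" "degree B \<le> e"
  shows "degree (form_subst d F A B) \<le> d * e"
  unfolding form_subst_def
proof (intro degree_sum_le)
  fix i assume "i \<in> {..d}"
  then have "degree (A ^ i) + degree (B ^ (d - i)) \<le> e * i + e * (d - i)"
    using degree_power_le[of A i] degree_power_le[of B "d - i"] assms
    by (meson add_mono le_trans mult_le_mono1)
  also have "\<dots> = d * e"
    using \<open>i \<in> {..d}\<close> by (simp add: distrib_left[symmetric] mult.commute)
  finally show "degree (smult (coeff F i) (A ^ i * B ^ (d - i))) \<le> d * e"
    using degree_smult_le[of "coeff F i"] degree_mult_le[of "A ^ i" "B ^ (d - i)"]
    by (meson le_trans)
qed simp

text \<open>Dehomogenization is harmless for iterated substitution as long as each polynomial is read as a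
  form of the stated degree; the degree bounds on \<open>A\<close> and \<open>B\<close> express exactly this. Associativity
  of composition, and its compatibility with evaluation at points, both rest on this identity.\<close>

lemma form_subst_subst:
  assumes "degree A \<le> e" "degree B \<le> e"
  shows "form_subst (d * e) (form_subst d F A B) C D =
    form_subst d F (form_subst e A C D) (form_subst e B C D)"
proof -
  have "form_subst (d * e) (A ^ i * B ^ (d - i)) C D =
      form_subst e A C D ^ i * form_subst e B C D ^ (d - i)" if "i \<le> d" for i
  proof -
    have deg: "degree (A ^ i) \<le> i * e" "degree (B ^ (d - i)) \<le> (d - i) * e"
      using degree_power_le[of A i] degree_power_le[of B "d - i"] assms
      by (metis le_trans mult.commute mult_le_mono1)+
    have "i * e + (d - i) * e = d * e"
      using that by (simp add: add_mult_distrib[symmetric])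
    then show ?thesis
      using form_subst_mult[OF deg, of C D]
      by (simp add: form_subst_power[OF assms(1)] form_subst_power[OF assms(2)])
  qed
  then show ?thesis
    by (simp add: form_subst_def[of d F] form_subst_sum form_subst_smult)
qed

lemma form_subst_ident:
  assumes "degree F \<le> d"
  shows "form_subst d F [:0, 1:] 1 = F"
proof -
  have "form_subst d F [:0, 1:] 1 = (\<Sum>i\<le>d. monom (coeff F i) i)"
    by (simp add: form_subst_def monom_altdef)
  then show ?thesis
    by (simp add: poly_as_sum_of_monoms'[OF assms])
qed

section \<open>Endomorphisms of the projective line over a ring of coefficients\<close>

text \<open>The two instances of interest are a whole field and its valuation ring, which share the calculus of
  representatives.\<close>

locale coeff_ring =
  fixes R :: "'a::comm_ring_1 set"
  assumes zero_mem [simp]: "0 \<in> R" and one_mem [simp]: "1 \<in> R"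
    and add_mem: "x \<in> R \<Longrightarrow> y \<in> R \<Longrightarrow> x + y \<in> R"
    and mult_mem: "x \<in> R \<Longrightarrow> y \<in> R \<Longrightarrow> x * y \<in> R"
begin

lemma sum_mem: "(\<And>i. i \<in> I \<Longrightarrow> f i \<in> R) \<Longrightarrow> (\<Sum>i\<in>I. f i) \<in> R"
  by (induction I rule: infinite_finite_induct) (auto intro: add_mem)

lemma power_mem: "c \<in> R \<Longrightarrow> c ^ n \<in> R"
  by (induction n) (auto intro: mult_mem)

lemma poly_over_pCons: "p \<in> poly_over R \<Longrightarrow> c \<in> R \<Longrightarrow> pCons c p \<in> poly_over R"
  by (auto simp: poly_over_def coeff_pCons split: nat.split)

lemma poly_over_0: "0 \<in> poly_over R"
  by (simp add: poly_over_def)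

lemma poly_over_1: "1 \<in> poly_over R"
  unfolding one_pCons by (intro poly_over_pCons poly_over_0) auto

lemma poly_over_X: "[:0, 1:] \<in> poly_over R"
  by (intro poly_over_pCons poly_over_0) auto

lemma poly_over_add: "p \<in> poly_over R \<Longrightarrow> q \<in> poly_over R \<Longrightarrow> p + q \<in> poly_over R"
  by (simp add: poly_over_def add_mem)

lemma poly_over_smult: "p \<in> poly_over R \<Longrightarrow> c \<in> R \<Longrightarrow> smult c p \<in> poly_over R"
  by (simp add: poly_over_def mult_mem)

lemma poly_over_mult: "p \<in> poly_over R \<Longrightarrow> q \<in> poly_over R \<Longrightarrow> p * q \<in> poly_over R"
  by (auto simp: poly_over_def coeff_mult intro!: sum_mem mult_mem)

lemma poly_over_power: "p \<in> poly_over R \<Longrightarrow> p ^ n \<in> poly_over R"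
  by (induction n) (auto intro: poly_over_mult poly_over_1)

lemma poly_over_sum:
  "(\<And>i. i \<in> I \<Longrightarrow> f i \<in> poly_over R) \<Longrightarrow> (\<Sum>i\<in>I. f i) \<in> poly_over R"
  by (induction I rule: infinite_finite_induct) (auto intro: poly_over_add poly_over_0)

lemma poly_over_form_subst:
  assumes "F \<in> poly_over R" "A \<in> poly_over R" "B \<in> poly_over R"
  shows "form_subst d F A B \<in> poly_over R"
  unfolding form_subst_def
  by (intro poly_over_sum poly_over_smult poly_over_mult poly_over_power assms)
     (use assms in \<open>simp add: poly_over_def\<close>)

lemmas poly_over_intros = poly_over_0 poly_over_1 poly_over_X poly_over_add poly_over_mult
  poly_over_power poly_over_smult poly_over_form_subst

lemma unit_idealI:
  "a \<in> poly_over R \<Longrightarrow> b \<in> poly_over R \<Longrightarrow> a * p + b * q = 1 \<Longrightarrow> unit_ideal R p q"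
  by (auto simp: unit_ideal_def)

lemma unit_ideal_sym: "unit_ideal R p q \<Longrightarrow> unit_ideal R q p"
  unfolding unit_ideal_def by (metis add.commute)

lemma unit_ideal_mult:
  assumes "p \<in> poly_over R" "p' \<in> poly_over R" "q \<in> poly_over R"
    and "unit_ideal R p q" "unit_ideal R p' q"
  shows "unit_ideal R (p * p') q"
proof -
  obtain a b where ab: "a \<in> poly_over R" "b \<in> poly_over R" "a * p + b * q = 1"
    using assms unfolding unit_ideal_def by blast
  obtain a' b' where ab': "a' \<in> poly_over R" "b' \<in> poly_over R" "a' * p' + b' * q = 1"
    using assms unfolding unit_ideal_def by blast
  have "1 = (a * p + b * q) * (a' * p' + b' * q)"
    using ab ab' by simp
  also have "\<dots> = (a * a') * (p * p') + (a * p * b' + b * (a' * p') + b * q * b') * q"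
    by (simp add: algebra_simps)
  finally show ?thesis
    by (intro unit_idealI[OF _ _ sym]) (auto intro!: poly_over_add poly_over_mult ab ab' assms)
qed

lemma unit_ideal_power:
  assumes "p \<in> poly_over R" "q \<in> poly_over R" "unit_ideal R p q"
  shows "unit_ideal R (p ^ n) q"
proof (induction n)
  case 0
  show ?case
    unfolding unit_ideal_def by (rule bexI[of _ 1], rule bexI[of _ 0]) (auto intro: poly_over_intros)
qed (use assms in \<open>auto intro: unit_ideal_mult poly_over_intros\<close>)

text \<open>If dehomogenizing at \<open>Y = 1\<close> gives generators of the unit ideal, then homogenizing a Bezout
  relation exhibits a power of \<open>Y\<close> in the ideal of the two forms.\<close>

lemma form_subst_power_in_ideal:
  assumes F: "degree F \<le> d" "degree G \<le> d" and "unit_ideal R F G"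
    and AB: "A \<in> poly_over R" "B \<in> poly_over R"
  shows "\<exists>n. \<exists>a\<in>poly_over R. \<exists>b\<in>poly_over R.
    a * form_subst d F A B + b * form_subst d G A B = B ^ n"
proof -
  obtain a b where ab: "a \<in> poly_over R" "b \<in> poly_over R" "a * F + b * G = 1"
    using assms unfolding unit_ideal_def by blast
  define n where "n = max (degree a) (degree b)"
  have "form_subst (n + d) (a * F + b * G) A B = B ^ (n + d)"
    unfolding ab(3) by (rule form_subst_1)
  then have "form_subst n a A B * form_subst d F A B + form_subst n b A B * form_subst d G A B = B ^ (n + d)"
    by (simp add: form_subst_add form_subst_mult F n_def)
  then show ?thesis
    using ab AB by (meson poly_over_form_subst)
qed

text \<open>Forms without a common zero, substituted into forms without a common zero, have no common zero.
  Algebraically: the ideal of the two composites contains a power of \<open>B\<close> (from the chart \<open>Y = 1\<close>) and a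
  power of \<open>A\<close> (from the chart \<open>X = 1\<close>), and these generate the unit ideal.\<close>

lemma unit_ideal_form_subst:
  assumes r: "(d, F, G) \<in> P1_reps R"
    and AB: "A \<in> poly_over R" "B \<in> poly_over R" "unit_ideal R A B"
  shows "unit_ideal R (form_subst d F A B) (form_subst d G A B)"
proof -
  have FG: "F \<in> poly_over R" "G \<in> poly_over R" "degree F \<le> d" "degree G \<le> d"
    and u1: "unit_ideal R F G"
    and u2: "unit_ideal R (form_subst d F 1 [:0, 1:]) (form_subst d G 1 [:0, 1:])"
    using r by (auto simp: P1_reps_def form_subst_ident)
  let ?F = "form_subst d F A B" and ?G = "form_subst d G A B"
  obtain n a b where n: "a \<in> poly_over R" "b \<in> poly_over R" "a * ?F + b * ?G = B ^ n"
    using form_subst_power_in_ideal[OF FG(3,4) u1 AB(1,2)] by blast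
  have deg: "degree (form_subst d H 1 [:0, 1:]) \<le> d" for H :: "'a poly"
    using degree_form_subst[of 1 1 "[:0, 1:]" d H] by simp
  \<comment> \<open>The second chart is the first one for the reversed forms, with \<open>A\<close> and \<open>B\<close> exchanged.\<close>
  have rev: "form_subst d (form_subst d H 1 [:0, 1:]) B A = form_subst d H A B" for H :: "'a poly"
    using form_subst_subst[of 1 1 "[:0, 1:]" d H B A]
    by (simp add: form_subst_1 form_subst_X del: One_nat_def)
  obtain m a' b' where m: "a' \<in> poly_over R" "b' \<in> poly_over R" "a' * ?F + b' * ?G = A ^ m"
    using form_subst_power_in_ideal[OF deg deg u2 AB(2,1)] unfolding rev by blast
  have "unit_ideal R (A ^ m) (B ^ n)"
    using AB by (intro unit_ideal_power unit_ideal_sym[OF unit_ideal_power]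
        unit_ideal_sym[OF AB(3)] poly_over_intros)
  then obtain s t where st: "s \<in> poly_over R" "t \<in> poly_over R" "s * A ^ m + t * B ^ n = 1"
    unfolding unit_ideal_def by blast
  have "(s * a' + t * a) * ?F + (s * b' + t * b) * ?G = 1"
    unfolding st(3)[symmetric] n(3)[symmetric] m(3)[symmetric] by (simp add: algebra_simps)
  then show ?thesis
    by (intro unit_idealI) (auto intro!: poly_over_add poly_over_mult st n m)
qed

end

lemma coeff_ring_UNIV: "coeff_ring UNIV"
  by unfold_locales auto

definition rep_scale :: "'a::comm_ring_1 \<Rightarrow> nat \<times> 'a poly \<times> 'a poly \<Rightarrow> nat \<times> 'a poly \<times> 'a poly" where
  "rep_scale c r = (case r of (d, F, G) \<Rightarrow> (d, smult c F, smult c G))"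

definition rep_comp :: "nat \<times> 'a::comm_ring_1 poly \<times> 'a poly \<Rightarrow> nat \<times> 'a poly \<times> 'a poly \<Rightarrow>
    nat \<times> 'a poly \<times> 'a poly" where
  "rep_comp r s = (case (r, s) of ((d, F, G), (e, A, B)) \<Rightarrow>
     (d * e, form_subst d F A B, form_subst d G A B))"

definition rep_one :: "nat \<times> 'a::comm_ring_1 poly \<times> 'a poly" where
  "rep_one = (1, [:0, 1:], 1)"

abbreviation mor :: "'a::comm_ring_1 set \<Rightarrow> nat \<times> 'a poly \<times> 'a poly \<Rightarrow> 'a P1_mor" where
  "mor R r \<equiv> P1_rel R `` {r}"

lemma rep_scale_scale: "rep_scale c (rep_scale c' r) = rep_scale (c * c') r"
  by (simp add: rep_scale_def split: prod.split)

lemma rep_scale_1 [simp]: "rep_scale 1 r = r"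
  by (simp add: rep_scale_def split: prod.split)

lemma fst_rep_scale [simp]: "fst (rep_scale c r) = fst r"
  by (simp add: rep_scale_def split: prod.split)

lemma fst_rep_comp [simp]: "fst (rep_comp r s) = fst r * fst s"
  by (simp add: rep_comp_def split: prod.split)

lemma P1_rel_iff:
  "(r, s) \<in> P1_rel R \<longleftrightarrow> r \<in> P1_reps R \<and> (\<exists>c\<in>R. (\<exists>c'\<in>R. c * c' = 1) \<and> s = rep_scale c r)"
  by (cases r; cases s) (auto simp: P1_rel_def rep_scale_def)

lemma form_subst_scale_args:
  "form_subst d F (smult c A) (smult c B) = smult (c ^ d) (form_subst d F A B)"
proof -
  have "smult c A ^ i * smult c B ^ (d - i) = smult (c ^ d) (A ^ i * B ^ (d - i))" if "i \<le> d" for i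
    using that by (simp add: smult_power power_add[symmetric])
  then show ?thesis
    by (simp add: form_subst_def smult_sum_right mult.commute)
qed

lemma rep_comp_scale:
  "rep_comp (rep_scale c r) (rep_scale c' s) = rep_scale (c * c' ^ fst r) (rep_comp r s)"
  by (simp add: rep_comp_def rep_scale_def form_subst_smult form_subst_scale_args split: prod.split)

lemma rep_comp_assoc:
  assumes "s \<in> P1_reps R"
  shows "rep_comp (rep_comp r s) t = rep_comp r (rep_comp s t)"
  using assms by (auto simp: rep_comp_def P1_reps_def form_subst_subst split: prod.split)

lemma rep_comp_one_right: "r \<in> P1_reps R \<Longrightarrow> rep_comp r rep_one = r"
  by (auto simp: rep_comp_def rep_one_def P1_reps_def form_subst_ident)

lemma rep_comp_one_left: "rep_comp rep_one r = r"
  by (auto simp: rep_comp_def rep_one_def form_subst_1 form_subst_X split: prod.split simp del: One_nat_def)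

context coeff_ring
begin

lemma rep_scale_mem:
  assumes "r \<in> P1_reps R" "c \<in> R" "c' \<in> R" "c * c' = 1"
  shows "rep_scale c r \<in> P1_reps R"
proof -
  have u: "unit_ideal R (smult c p) (smult c q)" if pq: "unit_ideal R p q" for p q
  proof -
    obtain a b where "a \<in> poly_over R" "b \<in> poly_over R" "a * p + b * q = 1"
      using pq unfolding unit_ideal_def by blast
    then have "smult c' a \<in> poly_over R" "smult c' b \<in> poly_over R"
      "smult c' a * smult c p + smult c' b * smult c q = 1"
      using assms by (auto intro: poly_over_smult simp: smult_add_right[symmetric] mult.commute)
    then show ?thesis
      unfolding unit_ideal_def by blast
  qed
  show ?thesis
    using assms
    by (auto simp: P1_reps_def rep_scale_def form_subst_smult intro!: u poly_over_smult
        intro: order.trans[OF degree_smult_le])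
qed

lemma equiv_P1_rel: "equiv (P1_reps R) (P1_rel R)"
proof (rule equivI)
  show "P1_rel R \<subseteq> P1_reps R \<times> P1_reps R"
  proof
    fix z assume "z \<in> P1_rel R"
    then show "z \<in> P1_reps R \<times> P1_reps R"
      by (cases z) (auto simp only: P1_rel_iff intro: rep_scale_mem)
  qed
  show "refl_on (P1_reps R) (P1_rel R)"
    by (auto simp: refl_on_def P1_rel_iff intro!: bexI[of _ 1] intro: rep_scale_mem)
  show "sym (P1_rel R)"
  proof (rule symI)
    fix r s assume "(r, s) \<in> P1_rel R"
    then obtain c c' where c: "r \<in> P1_reps R" "c \<in> R" "c' \<in> R" "c * c' = 1" "s = rep_scale c r"
      by (auto simp: P1_rel_iff)
    then have "r = rep_scale c' s" "s \<in> P1_reps R" "c' * c = 1"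
      by (auto simp: rep_scale_scale mult.commute intro: rep_scale_mem)
    then show "(s, r) \<in> P1_rel R"
      using c by (auto simp: P1_rel_iff)
  qed
  show "trans (P1_rel R)"
  proof (rule transI)
    fix r s t assume "(r, s) \<in> P1_rel R" "(s, t) \<in> P1_rel R"
    then obtain a a' b b' where "r \<in> P1_reps R" "a \<in> R" "a' \<in> R" "a * a' = 1" "s = rep_scale a r"
      "b \<in> R" "b' \<in> R" "b * b' = 1" "t = rep_scale b s"
      by (auto simp: P1_rel_iff)
    moreover from this have "(b * a) * (b' * a') = 1"
      by (metis mult.assoc mult.commute mult.right_neutral)
    ultimately show "(r, t) \<in> P1_rel R"
      unfolding P1_rel_iff by (metis mult_mem rep_scale_scale)
  qed
qed

lemma mor_self: "r \<in> P1_reps R \<Longrightarrow> r \<in> mor R r"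
  using equiv_P1_rel by (rule equiv_class_self)

lemma mor_eq_iff: "r \<in> P1_reps R \<Longrightarrow> s \<in> P1_reps R \<Longrightarrow> mor R r = mor R s \<longleftrightarrow> (r, s) \<in> P1_rel R"
  using equiv_P1_rel by (rule eq_equiv_class_iff)

lemma mor_carrier: "r \<in> P1_reps R \<Longrightarrow> mor R r \<in> carrier (P1_End R)"
  by (simp add: P1_End_def quotientI)

lemma carrier_mor:
  assumes "f \<in> carrier (P1_End R)"
  obtains r where "r \<in> P1_reps R" "f = mor R r"
  using assms by (auto simp: P1_End_def elim: quotientE)

lemma rel_Image_eq_mor:
  assumes "r \<in> S" "\<And>s. s \<in> S \<Longrightarrow> (r, s) \<in> P1_rel R"
  shows "P1_rel R `` S = mor R r"
proof
  show "P1_rel R `` S \<subseteq> mor R r"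
    using assms equiv_P1_rel unfolding equiv_def by (blast dest: transD)
qed (use assms in auto)

lemma rep_one_mem: "rep_one \<in> P1_reps R"
proof -
  have "unit_ideal R [:0, 1:] 1"
    unfolding unit_ideal_def by (rule bexI[of _ 0], rule bexI[of _ 1]) (auto intro: poly_over_intros)
  then show ?thesis
    by (auto simp: rep_one_def P1_reps_def form_subst_1 form_subst_X
        intro: poly_over_intros unit_ideal_sym simp del: One_nat_def)
qed

lemma rep_comp_mem:
  assumes "r \<in> P1_reps R" "s \<in> P1_reps R"
  shows "rep_comp r s \<in> P1_reps R"
proof -
  obtain d F G e A B where rs: "r = (d, F, G)" "s = (e, A, B)"
    by (metis prod_cases3)
  have FG: "F \<in> poly_over R" "G \<in> poly_over R"
    using assms(1) by (auto simp: rs P1_reps_def)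
  have AB: "A \<in> poly_over R" "B \<in> poly_over R" "degree A \<le> e" "degree B \<le> e"
    "unit_ideal R (form_subst e A [:0, 1:] 1) (form_subst e B [:0, 1:] 1)"
    "unit_ideal R (form_subst e A 1 [:0, 1:]) (form_subst e B 1 [:0, 1:])"
    using assms(2) by (auto simp: rs P1_reps_def)
  show ?thesis
    using FG AB assms(1)
    by (auto simp: rep_comp_def rs P1_reps_def form_subst_subst
        intro!: poly_over_form_subst degree_form_subst unit_ideal_form_subst poly_over_intros)
qed

lemma mor_comp:
  assumes "r \<in> P1_reps R" "s \<in> P1_reps R"
  shows "mor R r \<otimes>\<^bsub>P1_End R\<^esub> mor R s = mor R (rep_comp r s)"
proof -
  let ?S = "{rep_comp r' s' |r' s'. r' \<in> mor R r \<and> s' \<in> mor R s}"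
  have "mor R r \<otimes>\<^bsub>P1_End R\<^esub> mor R s = P1_rel R `` ?S"
    unfolding P1_End_def P1_comp_def monoid.simps
    by (rule arg_cong[where f = "\<lambda>S. P1_rel R `` S"])
       (unfold rep_comp_def, simp only: split_paired_Ex prod.case)
  also have "\<dots> = mor R (rep_comp r s)"
  proof (rule rel_Image_eq_mor)
    show "rep_comp r s \<in> ?S"
      using assms mor_self by blast
    fix t assume "t \<in> ?S"
    then obtain a a' b b' where c: "a \<in> R" "a' \<in> R" "a * a' = 1" "b \<in> R" "b' \<in> R" "b * b' = 1"
      "t = rep_comp (rep_scale a r) (rep_scale b s)"
      by (auto simp: P1_rel_iff)
    have "(a * b ^ fst r) * (a' * b' ^ fst r) = (a * a') * (b * b') ^ fst r"
      by (simp add: power_mult_distrib mult_ac)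
    also have "\<dots> = 1"
      using c by simp
    finally show "(rep_comp r s, t) \<in> P1_rel R"
      using c assms unfolding P1_rel_iff
      by (metis mult_mem power_mem rep_comp_mem rep_comp_scale)
  qed
  finally show ?thesis .
qed

lemma mor_one: "\<one>\<^bsub>P1_End R\<^esub> = mor R rep_one"
  by (simp add: P1_End_def rep_one_def)

lemma monoid_P1_End: "monoid (P1_End R)"
proof (rule monoidI)
  fix f g assume "f \<in> carrier (P1_End R)" "g \<in> carrier (P1_End R)"
  then show "f \<otimes>\<^bsub>P1_End R\<^esub> g \<in> carrier (P1_End R)"
    by (metis carrier_mor mor_comp mor_carrier rep_comp_mem)
next
  show "\<one>\<^bsub>P1_End R\<^esub> \<in> carrier (P1_End R)"
    by (simp add: mor_one mor_carrier rep_one_mem)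
next
  fix f g h
  assume "f \<in> carrier (P1_End R)" "g \<in> carrier (P1_End R)" "h \<in> carrier (P1_End R)"
  then obtain r s t where "r \<in> P1_reps R" "f = mor R r" "s \<in> P1_reps R" "g = mor R s"
    "t \<in> P1_reps R" "h = mor R t"
    by (metis carrier_mor)
  then show "f \<otimes>\<^bsub>P1_End R\<^esub> g \<otimes>\<^bsub>P1_End R\<^esub> h = f \<otimes>\<^bsub>P1_End R\<^esub> (g \<otimes>\<^bsub>P1_End R\<^esub> h)"
    by (simp add: mor_comp rep_comp_mem rep_comp_assoc)
next
  fix f assume "f \<in> carrier (P1_End R)"
  then obtain r where "r \<in> P1_reps R" "f = mor R r"
    by (metis carrier_mor)
  then show "\<one>\<^bsub>P1_End R\<^esub> \<otimes>\<^bsub>P1_End R\<^esub> f = f" "f \<otimes>\<^bsub>P1_End R\<^esub> \<one>\<^bsub>P1_End R\<^esub> = f"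
    by (simp_all add: mor_one mor_comp rep_one_mem rep_comp_one_left rep_comp_one_right)
qed

text \<open>A matrix with an inverse over \<open>R\<close> defines a morphism over \<open>R\<close>: the entries of the inverse are the
  coefficients of the required Bezout relations, one row for each chart.\<close>

lemma rep_mem_if_left_inverse:
  assumes "degree A\<^sub>1 \<le> 1" "degree A\<^sub>2 \<le> 1" "degree B\<^sub>1 \<le> 1" "degree B\<^sub>2 \<le> 1"
    and "A\<^sub>1 \<in> poly_over R" "A\<^sub>2 \<in> poly_over R" "B\<^sub>1 \<in> poly_over R" "B\<^sub>2 \<in> poly_over R"
    and inverse: "rep_comp (1, B\<^sub>1, B\<^sub>2) (1, A\<^sub>1, A\<^sub>2) = rep_one"
  shows "(1, A\<^sub>1, A\<^sub>2) \<in> P1_reps R"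
proof -
  have B: "form_subst 1 B\<^sub>1 A\<^sub>1 A\<^sub>2 = [:0, 1:]" "form_subst 1 B\<^sub>2 A\<^sub>1 A\<^sub>2 = 1"
    using inverse by (simp_all add: rep_comp_def rep_one_def)
  have gen: "unit_ideal R C D" if "form_subst 1 H C D = 1" "H \<in> poly_over R" for H C D
    using that
    by (intro unit_idealI[of "[:coeff H 1:]" "[:coeff H 0:]"] poly_over_pCons poly_over_0)
       (auto simp: form_subst_linear poly_over_def add.commute simp del: One_nat_def)
  have "form_subst 1 B\<^sub>1 (form_subst 1 A\<^sub>1 1 [:0, 1:]) (form_subst 1 A\<^sub>2 1 [:0, 1:]) = 1"
    using form_subst_subst[OF assms(1,2), of 1 B\<^sub>1 1 "[:0, 1:]"] B(1)
    by (simp add: form_subst_X del: One_nat_def)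
  moreover have "form_subst 1 B\<^sub>2 (form_subst 1 A\<^sub>1 [:0, 1:] 1) (form_subst 1 A\<^sub>2 [:0, 1:] 1) = 1"
    using assms B(2) by (simp add: form_subst_ident)
  ultimately show ?thesis
    using assms by (auto simp: P1_reps_def simp del: One_nat_def intro: gen)
qed

end

section \<open>Base change\<close>

definition rep_map :: "('a::comm_ring_1 \<Rightarrow> 'b::comm_ring_1) \<Rightarrow> nat \<times> 'a poly \<times> 'a poly \<Rightarrow>
    nat \<times> 'b poly \<times> 'b poly" where
  "rep_map h r = (case r of (d, F, G) \<Rightarrow> (d, map_poly h F, map_poly h G))"

text \<open>The map \<open>h\<close> is required to be a homomorphism on \<open>R\<close> only: a residue map is defined on the whole field
  as a function, but is multiplicative and additive just on the valuation ring.\<close>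

locale coeff_hom = R: coeff_ring R + S: coeff_ring S
  for R :: "'a::comm_ring_1 set" and S :: "'b::comm_ring_1 set" +
  fixes h :: "'a \<Rightarrow> 'b"
  assumes hom_mem: "x \<in> R \<Longrightarrow> h x \<in> S"
    and hom_0 [simp]: "h 0 = 0" and hom_1 [simp]: "h 1 = 1"
    and hom_add: "x \<in> R \<Longrightarrow> y \<in> R \<Longrightarrow> h (x + y) = h x + h y"
    and hom_mult: "x \<in> R \<Longrightarrow> y \<in> R \<Longrightarrow> h (x * y) = h x * h y"
begin

lemma hom_sum: "(\<And>i. i \<in> I \<Longrightarrow> f i \<in> R) \<Longrightarrow> h (\<Sum>i\<in>I. f i) = (\<Sum>i\<in>I. h (f i))"
  by (induction I rule: infinite_finite_induct) (auto simp: hom_add R.sum_mem)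

lemma map_poly_mem: "p \<in> poly_over R \<Longrightarrow> map_poly h p \<in> poly_over S"
  by (simp add: poly_over_def coeff_map_poly hom_mem)

lemma map_poly_add:
  "p \<in> poly_over R \<Longrightarrow> q \<in> poly_over R \<Longrightarrow> map_poly h (p + q) = map_poly h p + map_poly h q"
  by (simp add: poly_eq_iff poly_over_def coeff_map_poly hom_add)

lemma map_poly_smult:
  "p \<in> poly_over R \<Longrightarrow> c \<in> R \<Longrightarrow> map_poly h (smult c p) = smult (h c) (map_poly h p)"
  by (simp add: poly_eq_iff poly_over_def coeff_map_poly hom_mult)

lemma map_poly_mult:
  "p \<in> poly_over R \<Longrightarrow> q \<in> poly_over R \<Longrightarrow> map_poly h (p * q) = map_poly h p * map_poly h q"
  by (simp add: poly_eq_iff poly_over_def coeff_map_poly coeff_mult hom_sum hom_mult R.mult_mem)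

lemma map_poly_power: "p \<in> poly_over R \<Longrightarrow> map_poly h (p ^ n) = map_poly h p ^ n"
  by (induction n) (simp_all add: map_poly_mult R.poly_over_power)

lemma map_poly_sum:
  "(\<And>i. i \<in> I \<Longrightarrow> f i \<in> poly_over R) \<Longrightarrow> map_poly h (\<Sum>i\<in>I. f i) = (\<Sum>i\<in>I. map_poly h (f i))"
  by (induction I rule: infinite_finite_induct) (auto simp: map_poly_add R.poly_over_sum)

lemma map_poly_form_subst:
  assumes "F \<in> poly_over R" "A \<in> poly_over R" "B \<in> poly_over R"
  shows "map_poly h (form_subst d F A B) = form_subst d (map_poly h F) (map_poly h A) (map_poly h B)"
proof -
  have "coeff F i \<in> R" for i
    using assms by (simp add: poly_over_def)
  then show ?thesis
    using assms unfolding form_subst_def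
    by (simp add: map_poly_sum map_poly_smult map_poly_mult map_poly_power coeff_map_poly
        R.poly_over_smult R.poly_over_mult R.poly_over_power)
qed

lemma map_poly_X: "map_poly h [:0, 1:] = [:0, 1:]"
  by (simp add: map_poly_pCons)

lemma unit_ideal_map:
  assumes "p \<in> poly_over R" "q \<in> poly_over R" "unit_ideal R p q"
  shows "unit_ideal S (map_poly h p) (map_poly h q)"
proof -
  obtain a b where ab: "a \<in> poly_over R" "b \<in> poly_over R" "a * p + b * q = 1"
    using assms(3) unfolding unit_ideal_def by blast
  have "map_poly h a * map_poly h p + map_poly h b * map_poly h q = map_poly h (a * p + b * q)"
    using ab(1,2) assms by (simp add: map_poly_add map_poly_mult R.poly_over_mult)
  then have "map_poly h a * map_poly h p + map_poly h b * map_poly h q = 1"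
    using ab(3) by simp
  then show ?thesis
    using ab by (intro S.unit_idealI[of "map_poly h a" "map_poly h b"]) (auto simp: map_poly_mem)
qed

lemma rep_map_mem:
  assumes "r \<in> P1_reps R"
  shows "rep_map h r \<in> P1_reps S"
proof -
  obtain d F G where r: "r = (d, F, G)"
    by (metis prod_cases3)
  have FG: "F \<in> poly_over R" "G \<in> poly_over R" "degree F \<le> d" "degree G \<le> d"
    "unit_ideal R (form_subst d F [:0, 1:] 1) (form_subst d G [:0, 1:] 1)"
    "unit_ideal R (form_subst d F 1 [:0, 1:]) (form_subst d G 1 [:0, 1:])"
    using assms by (auto simp: r P1_reps_def)
  have deg: "degree (map_poly h p) \<le> d" if "degree p \<le> d" for p
    using that by (intro degree_le) (auto simp: coeff_map_poly coeff_eq_0)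
  show ?thesis
    using unit_ideal_map[OF _ _ FG(5)] unit_ideal_map[OF _ _ FG(6)] FG
    by (auto simp: rep_map_def r P1_reps_def map_poly_form_subst map_poly_X map_poly_mem deg
        R.poly_over_intros)
qed

lemma rep_map_scale:
  "r \<in> P1_reps R \<Longrightarrow> c \<in> R \<Longrightarrow> rep_map h (rep_scale c r) = rep_scale (h c) (rep_map h r)"
  by (auto simp: rep_map_def rep_scale_def P1_reps_def map_poly_smult)

lemma rep_map_comp:
  "r \<in> P1_reps R \<Longrightarrow> s \<in> P1_reps R \<Longrightarrow> rep_map h (rep_comp r s) = rep_comp (rep_map h r) (rep_map h s)"
  by (auto simp: rep_map_def rep_comp_def P1_reps_def map_poly_form_subst)

lemma rep_map_one: "rep_map h rep_one = rep_one"
  by (simp add: rep_map_def rep_one_def map_poly_X)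

lemma base_change_mor:
  assumes "r \<in> P1_reps R"
  shows "P1_base_change S h (mor R r) = mor S (rep_map h r)"
proof -
  have "P1_base_change S h (mor R r) = P1_rel S `` (rep_map h ` mor R r)"
    unfolding P1_base_change_def
    by (rule arg_cong[where f = "\<lambda>T. P1_rel S `` T"])
       (unfold rep_map_def image_def, simp only: split_paired_Ex prod.case Bex_def, blast)
  also have "\<dots> = mor S (rep_map h r)"
  proof (rule S.rel_Image_eq_mor)
    show "rep_map h r \<in> rep_map h ` mor R r"
      using assms R.mor_self by blast
    fix s assume "s \<in> rep_map h ` mor R r"
    then obtain c c' where c: "c \<in> R" "c' \<in> R" "c * c' = 1" "s = rep_map h (rep_scale c r)"
      by (auto simp only: P1_rel_iff Image_singleton_iff)
    have "h c * h c' = 1"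
      using c hom_mult[of c c'] by simp
    then have "\<exists>a\<in>S. (\<exists>a'\<in>S. a * a' = 1) \<and> s = rep_scale a (rep_map h r)"
      using c assms rep_map_scale hom_mem by blast
    then show "(rep_map h r, s) \<in> P1_rel S"
      using assms by (simp only: P1_rel_iff rep_map_mem simp_thms)
  qed
  finally show ?thesis .
qed

end

lemma rep_map_id [simp]: "rep_map id r = r"
  by (simp add: rep_map_def split: prod.split)

section \<open>Evaluation on the affine plane\<close>

definition form_eval :: "nat \<Rightarrow> 'a::comm_ring_1 poly \<Rightarrow> 'a \<Rightarrow> 'a \<Rightarrow> 'a" where
  "form_eval d F x y = (\<Sum>i\<le>d. coeff F i * x ^ i * y ^ (d - i))"

definition rep_eval :: "nat \<times> 'a::comm_ring_1 poly \<times> 'a poly \<Rightarrow> 'a \<times> 'a \<Rightarrow> 'a \<times> 'a" where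
  "rep_eval r p = (case r of (d, F, G) \<Rightarrow>
     (form_eval d F (fst p) (snd p), form_eval d G (fst p) (snd p)))"

definition vec_scale :: "'a::comm_ring_1 \<Rightarrow> 'a \<times> 'a \<Rightarrow> 'a \<times> 'a" where
  "vec_scale c p = (c * fst p, c * snd p)"

lemma form_subst_const: "form_subst d F [:x:] [:y:] = [:form_eval d F x y:]"
proof -
  have "[:\<Sum>i\<in>I. f i:] = (\<Sum>i\<in>I. [:f i:])" for f :: "nat \<Rightarrow> 'a" and I
  proof (induction I rule: infinite_finite_induct)
    case (insert x I)
    then show ?case
      by (metis add_0 add_pCons sum.insert)
  qed simp_all
  then show ?thesis
    by (simp add: form_subst_def form_eval_def poly_const_pow mult_ac)
qed

lemma poly_form_subst: "poly (form_subst d F A B) t = form_eval d F (poly A t) (poly B t)"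
  by (simp add: form_subst_def form_eval_def poly_sum mult.assoc)

lemma form_eval_dehomogenize: "degree F \<le> d \<Longrightarrow> form_eval d F t 1 = poly F t"
  using poly_form_subst[of d F "[:0, 1:]" 1 t] by (simp add: form_subst_ident)

lemma form_eval_scale: "form_eval d F (c * x) (c * y) = c ^ d * form_eval d F x y"
  unfolding form_eval_def sum_distrib_left
proof (intro sum.cong refl)
  fix i assume "i \<in> {..d}"
  then have "c ^ d = c ^ i * c ^ (d - i)"
    by (simp add: power_add[symmetric])
  then show "coeff F i * (c * x) ^ i * (c * y) ^ (d - i) = c ^ d * (coeff F i * x ^ i * y ^ (d - i))"
    by (simp add: power_mult_distrib mult_ac)
qed

lemma form_eval_smult: "form_eval d (smult c F) x y = c * form_eval d F x y"
  by (simp add: form_eval_def sum_distrib_left mult_ac)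

lemma form_eval_diff: "form_eval d (F - G) x y = form_eval d F x y - form_eval d G x y"
  by (simp add: form_eval_def sum_subtractf left_diff_distrib)

lemma form_eval_mult:
  assumes "degree p \<le> m" "degree q \<le> n"
  shows "form_eval (m + n) (p * q) x y = form_eval m p x y * form_eval n q x y"
  using form_subst_mult[OF assms, of "[:x:]" "[:y:]"] by (simp add: form_subst_const)

lemma form_eval_linear: "form_eval 1 F x y = coeff F 0 * y + coeff F 1 * x"
  by (simp add: form_eval_def)

lemma form_eval_pCons: "form_eval 1 [:b, a:] x y = b * y + a * x"
  by (simp add: form_eval_def)

lemma rep_eval_comp:
  assumes "s \<in> P1_reps R"
  shows "rep_eval (rep_comp r s) p = rep_eval r (rep_eval s p)"
proof -
  obtain d F G e A B where rs: "r = (d, F, G)" "s = (e, A, B)"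
    by (metis prod_cases3)
  have "form_eval (d * e) (form_subst d H A B) x y = form_eval d H (form_eval e A x y) (form_eval e B x y)"
    for H x y
    using form_subst_subst[of A e B d H "[:x:]" "[:y:]"] assms
    by (simp add: rs P1_reps_def form_subst_const)
  then show ?thesis
    by (simp add: rs rep_comp_def rep_eval_def)
qed

lemma rep_eval_one [simp]: "rep_eval rep_one p = p"
  by (simp add: rep_eval_def rep_one_def form_eval_def)

lemma rep_eval_scale: "rep_eval (rep_scale c r) p = vec_scale c (rep_eval r p)"
  by (simp add: rep_eval_def rep_scale_def vec_scale_def form_eval_smult split: prod.split)

lemma rep_eval_vec_scale: "rep_eval r (vec_scale c p) = vec_scale (c ^ fst r) (rep_eval r p)"
  by (simp add: rep_eval_def vec_scale_def form_eval_scale split: prod.split)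

section \<open>Automorphisms over a field\<close>

lemma P1_rel_UNIV_iff:
  fixes r s :: "nat \<times> 'a::field poly \<times> 'a poly"
  shows "(r, s) \<in> P1_rel UNIV \<longleftrightarrow> r \<in> P1_reps UNIV \<and> (\<exists>c. c \<noteq> 0 \<and> s = rep_scale c r)"
proof -
  have "(\<exists>c'. c * c' = 1) \<longleftrightarrow> c \<noteq> 0" for c :: 'a
    by (metis mult_zero_left right_inverse zero_neq_one)
  then show ?thesis
    by (simp add: P1_rel_iff)
qed

text \<open>The two forms of a representative do not both vanish, so its scaling constant is determined.\<close>

lemma rep_scale_cancel:
  fixes r :: "nat \<times> 'a::field poly \<times> 'a poly"
  assumes "r \<in> P1_reps UNIV" "rep_scale c r = r"
  shows "c = 1"
proof -
  obtain d F G where r: "r = (d, F, G)"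
    by (metis prod_cases3)
  have "unit_ideal UNIV F G"
    using assms(1) by (auto simp: r P1_reps_def form_subst_ident)
  then have "F \<noteq> 0 \<or> G \<noteq> 0"
    by (auto simp: unit_ideal_def)
  moreover have "smult (c - 1) F = 0" "smult (c - 1) G = 0"
    using assms(2) by (auto simp: r rep_scale_def smult_diff_left)
  ultimately show ?thesis
    by auto
qed

text \<open>Degrees multiply under composition, so invertible morphisms are given by pairs of linear forms, that is by
  matrices up to scalars. The scalar of \<open>B\<close> can be normalized to make \<open>B\<close> an exact right inverse
  of \<open>A\<close>; it is then automatically an exact left inverse.\<close>

lemma Units_P1_End_rep:
  fixes f :: "'a::field P1_mor"
  assumes "f \<in> Units (P1_End UNIV)"
  obtains A B where "A \<in> P1_reps UNIV" "B \<in> P1_reps UNIV" "fst A = 1" "fst B = 1"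
    "f = mor UNIV A" "inv\<^bsub>P1_End UNIV\<^esub> f = mor UNIV B"
    "rep_comp A B = rep_one" "rep_comp B A = rep_one"
proof -
  interpret R: coeff_ring "UNIV :: 'a set"
    by (rule coeff_ring_UNIV)
  interpret E: monoid "P1_End (UNIV :: 'a set)"
    by (rule R.monoid_P1_End)
  obtain A where A: "A \<in> P1_reps UNIV" "f = mor UNIV A"
    using assms by (meson E.Units_closed R.carrier_mor)
  obtain B\<^sub>0 where B\<^sub>0: "B\<^sub>0 \<in> P1_reps UNIV" "inv\<^bsub>P1_End UNIV\<^esub> f = mor UNIV B\<^sub>0"
    using assms by (meson E.Units_inv_closed R.carrier_mor)
  have "mor UNIV (rep_comp A B\<^sub>0) = mor UNIV rep_one"
    using E.Units_r_inv[OF assms] A B\<^sub>0 by (simp add: R.mor_comp R.mor_one)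
  then obtain c where c: "c \<noteq> 0" "rep_one = rep_scale c (rep_comp A B\<^sub>0)"
    using A B\<^sub>0 by (auto simp: R.mor_eq_iff R.rep_comp_mem R.rep_one_mem P1_rel_UNIV_iff)
  have "fst A * fst B\<^sub>0 = 1"
    using arg_cong[OF c(2), of fst] by (simp add: rep_one_def)
  then have deg: "fst A = 1" "fst B\<^sub>0 = 1"
    by simp_all
  define B where "B = rep_scale c B\<^sub>0"
  have B: "B \<in> P1_reps UNIV" "mor UNIV B = mor UNIV B\<^sub>0"
  proof -
    have "(B\<^sub>0, B) \<in> P1_rel UNIV"
      unfolding P1_rel_UNIV_iff B_def using c B\<^sub>0 by blast
    moreover from this show "B \<in> P1_reps UNIV"
      using R.equiv_P1_rel by (auto dest: equiv_type)
    ultimately show "mor UNIV B = mor UNIV B\<^sub>0"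
      using B\<^sub>0 R.mor_eq_iff by blast
  qed
  have AB: "rep_comp A B = rep_one"
    using rep_comp_scale[of 1 A c B\<^sub>0] c deg by (simp add: B_def)
  have "mor UNIV (rep_comp B A) = mor UNIV rep_one"
    using E.Units_l_inv[OF assms] A B\<^sub>0 B by (simp add: R.mor_comp[symmetric] R.mor_one)
  then obtain c' where c': "rep_comp B A = rep_scale c' rep_one"
    using A B by (metis P1_rel_UNIV_iff R.mor_eq_iff R.rep_comp_mem R.rep_one_mem)
  \<comment> \<open>Bracketing \<open>A B A\<close> in two ways shows that the remaining scalar is 1.\<close>
  have "rep_scale c' A = rep_comp A (rep_comp B A)"
    unfolding c' using rep_comp_scale[of 1 A c' rep_one] deg A by (simp add: rep_comp_one_right)
  also have "\<dots> = A"
    using rep_comp_assoc[OF B(1), of A A] by (simp add: AB rep_comp_one_left)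
  finally have "c' = 1"
    by (rule rep_scale_cancel[OF A(1)])
  then have "rep_comp B A = rep_one"
    by (simp add: c')
  moreover have "fst B = 1"
    using deg by (simp add: B_def)
  ultimately show thesis
    using that A B AB deg B\<^sub>0 by simp
qed

text \<open>Conjugation invariance is restated as commutation, which does not mention inverses and is preserved by any
  multiplicative map.\<close>

lemma P1_Aut_iff:
  fixes \<phi> :: "'a::field P1_mor"
  assumes "\<phi> \<in> carrier (P1_End UNIV)"
  shows "f \<in> carrier (P1_Aut UNIV \<phi>) \<longleftrightarrow>
    f \<in> Units (P1_End UNIV) \<and> f \<otimes>\<^bsub>P1_End UNIV\<^esub> \<phi> = \<phi> \<otimes>\<^bsub>P1_End UNIV\<^esub> f"
proof -
  interpret E: monoid "P1_End (UNIV :: 'a set)"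
    by (rule coeff_ring.monoid_P1_End[OF coeff_ring_UNIV])
  have "f \<otimes>\<^bsub>P1_End UNIV\<^esub> \<phi> \<otimes>\<^bsub>P1_End UNIV\<^esub> inv\<^bsub>P1_End UNIV\<^esub> f = \<phi> \<longleftrightarrow>
      f \<otimes>\<^bsub>P1_End UNIV\<^esub> \<phi> = \<phi> \<otimes>\<^bsub>P1_End UNIV\<^esub> f"
    if f: "f \<in> Units (P1_End UNIV)"
  proof
    assume "f \<otimes>\<^bsub>P1_End UNIV\<^esub> \<phi> \<otimes>\<^bsub>P1_End UNIV\<^esub> inv\<^bsub>P1_End UNIV\<^esub> f = \<phi>"
    then have "\<phi> \<otimes>\<^bsub>P1_End UNIV\<^esub> f =
        f \<otimes>\<^bsub>P1_End UNIV\<^esub> \<phi> \<otimes>\<^bsub>P1_End UNIV\<^esub> (inv\<^bsub>P1_End UNIV\<^esub> f \<otimes>\<^bsub>P1_End UNIV\<^esub> f)"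
      using f assms by (metis E.Units_closed E.Units_inv_closed E.m_assoc E.m_closed)
    then show "f \<otimes>\<^bsub>P1_End UNIV\<^esub> \<phi> = \<phi> \<otimes>\<^bsub>P1_End UNIV\<^esub> f"
      using f assms by (simp add: E.Units_closed)
  next
    assume "f \<otimes>\<^bsub>P1_End UNIV\<^esub> \<phi> = \<phi> \<otimes>\<^bsub>P1_End UNIV\<^esub> f"
    then show "f \<otimes>\<^bsub>P1_End UNIV\<^esub> \<phi> \<otimes>\<^bsub>P1_End UNIV\<^esub> inv\<^bsub>P1_End UNIV\<^esub> f = \<phi>"
      using f assms by (simp add: E.m_assoc E.Units_closed)
  qed
  then show ?thesis
    by (auto simp: P1_Aut_def)
qed

lemma P1_Aut_simps [simp]:
  "monoid.mult (P1_Aut R \<phi>) = monoid.mult (P1_End R)" "one (P1_Aut R \<phi>) = one (P1_End R)"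
  by (simp_all add: P1_Aut_def units_of_def)

lemma group_P1_Aut:
  fixes \<phi> :: "'a::field P1_mor"
  assumes \<phi>: "\<phi> \<in> carrier (P1_End UNIV)"
  shows "group (P1_Aut UNIV \<phi>)"
    and "f \<in> carrier (P1_Aut UNIV \<phi>) \<Longrightarrow> inv\<^bsub>P1_End UNIV\<^esub> f \<in> carrier (P1_Aut UNIV \<phi>)"
proof -
  interpret E: monoid "P1_End (UNIV :: 'a set)"
    by (rule coeff_ring.monoid_P1_End[OF coeff_ring_UNIV])
  interpret U: group "units_of (P1_End (UNIV :: 'a set))"
    by (rule E.units_group)
  let ?H = "carrier (P1_Aut UNIV \<phi>)"
  note Aut = P1_Aut_iff[OF \<phi>]
  have inv: "inv\<^bsub>P1_End UNIV\<^esub> f \<in> ?H" if "f \<in> ?H" for f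
  proof -
    let ?g = "inv\<^bsub>P1_End UNIV\<^esub> f"
    have f: "f \<in> Units (P1_End UNIV)" "f \<otimes>\<^bsub>P1_End UNIV\<^esub> \<phi> = \<phi> \<otimes>\<^bsub>P1_End UNIV\<^esub> f"
      using that by (auto simp: Aut)
    have "?g \<otimes>\<^bsub>P1_End UNIV\<^esub> \<phi> = ?g \<otimes>\<^bsub>P1_End UNIV\<^esub> (\<phi> \<otimes>\<^bsub>P1_End UNIV\<^esub> f) \<otimes>\<^bsub>P1_End UNIV\<^esub> ?g"
      using f(1) \<phi> by (simp add: E.m_assoc E.Units_closed)
    also have "\<dots> = ?g \<otimes>\<^bsub>P1_End UNIV\<^esub> f \<otimes>\<^bsub>P1_End UNIV\<^esub> \<phi> \<otimes>\<^bsub>P1_End UNIV\<^esub> ?g"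
      unfolding f(2)[symmetric] using f(1) \<phi> by (simp only: E.m_assoc E.Units_closed E.Units_inv_closed E.m_closed)
    also have "\<dots> = \<phi> \<otimes>\<^bsub>P1_End UNIV\<^esub> ?g"
      using f(1) \<phi> by simp
    finally show ?thesis
      using f(1) \<phi> by (simp add: Aut)
  qed
  then show "f \<in> ?H \<Longrightarrow> inv\<^bsub>P1_End UNIV\<^esub> f \<in> ?H" .
  have "subgroup ?H (units_of (P1_End UNIV))"
  proof (rule U.subgroupI)
    show "?H \<subseteq> carrier (units_of (P1_End UNIV))"
      by (auto simp: Aut units_of_def)
    have "\<one>\<^bsub>P1_End UNIV\<^esub> \<in> ?H"
      using \<phi> by (simp add: Aut)
    then show "?H \<noteq> {}"
      by blast
    show "inv\<^bsub>units_of (P1_End UNIV)\<^esub> f \<in> ?H" if "f \<in> ?H" for f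
      using that inv by (simp add: E.units_of_inv Aut)
    show "f \<otimes>\<^bsub>units_of (P1_End UNIV)\<^esub> g \<in> ?H" if "f \<in> ?H" "g \<in> ?H" for f g
    proof -
      have fg: "f \<in> Units (P1_End UNIV)" "f \<otimes>\<^bsub>P1_End UNIV\<^esub> \<phi> = \<phi> \<otimes>\<^bsub>P1_End UNIV\<^esub> f"
        "g \<in> Units (P1_End UNIV)" "g \<otimes>\<^bsub>P1_End UNIV\<^esub> \<phi> = \<phi> \<otimes>\<^bsub>P1_End UNIV\<^esub> g"
        using that by (auto simp: Aut)
      have "f \<otimes>\<^bsub>P1_End UNIV\<^esub> g \<otimes>\<^bsub>P1_End UNIV\<^esub> \<phi> = f \<otimes>\<^bsub>P1_End UNIV\<^esub> \<phi> \<otimes>\<^bsub>P1_End UNIV\<^esub> g"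
        using fg(1,3,4) \<phi> by (simp add: E.m_assoc E.Units_closed)
      also have "\<dots> = \<phi> \<otimes>\<^bsub>P1_End UNIV\<^esub> (f \<otimes>\<^bsub>P1_End UNIV\<^esub> g)"
        unfolding fg(2) using fg(1,3) \<phi> by (simp add: E.m_assoc E.Units_closed)
      finally show ?thesis
        using fg \<phi> by (simp add: Aut units_of_mult)
    qed
  qed
  then have "group ((units_of (P1_End UNIV)) \<lparr>carrier := ?H\<rparr>)"
    by (rule U.subgroup_imp_group)
  then show "group (P1_Aut UNIV \<phi>)"
    by (simp add: P1_Aut_def)
qed

lemma P1_Aut_rep:
  fixes \<Phi> :: "nat \<times> 'a::field poly \<times> 'a poly"
  assumes "\<Phi> \<in> P1_reps UNIV" "f \<in> carrier (P1_Aut UNIV (mor UNIV \<Phi>))"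
  obtains A B c where "A \<in> P1_reps UNIV" "B \<in> P1_reps UNIV" "fst A = 1" "fst B = 1"
    "f = mor UNIV A" "rep_comp A B = rep_one" "rep_comp B A = rep_one"
    "c \<noteq> 0" "rep_comp \<Phi> A = rep_scale c (rep_comp A \<Phi>)"
proof -
  interpret R: coeff_ring "UNIV :: 'a set"
    by (rule coeff_ring_UNIV)
  have f: "f \<in> Units (P1_End UNIV)"
    "f \<otimes>\<^bsub>P1_End UNIV\<^esub> mor UNIV \<Phi> = mor UNIV \<Phi> \<otimes>\<^bsub>P1_End UNIV\<^esub> f"
    using assms by (auto simp: P1_Aut_iff R.mor_carrier)
  obtain A B where AB: "A \<in> P1_reps UNIV" "B \<in> P1_reps UNIV" "fst A = 1" "fst B = 1"
    "f = mor UNIV A" "rep_comp A B = rep_one" "rep_comp B A = rep_one"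
    using Units_P1_End_rep[OF f(1)] by metis
  have "mor UNIV (rep_comp A \<Phi>) = mor UNIV (rep_comp \<Phi> A)"
    using f(2) AB assms by (simp add: R.mor_comp)
  then obtain c where "c \<noteq> 0" "rep_comp \<Phi> A = rep_scale c (rep_comp A \<Phi>)"
    using AB assms by (metis P1_rel_UNIV_iff R.mor_eq_iff R.rep_comp_mem)
  then show thesis
    using that AB by blast
qed

section \<open>Morphisms over the valuation ring\<close>

locale nonarch =
  fixes v :: "'k::field \<Rightarrow> real"
  assumes nonarch: "nonarch_abs v"
begin

lemma v_nonneg [simp]: "v x \<ge> 0"
  and v_eq_0_iff [simp]: "v x = 0 \<longleftrightarrow> x = 0"
  and v_mult: "v (x * y) = v x * v y"
  and v_add: "v (x + y) \<le> max (v x) (v y)"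
  using nonarch by (auto simp: nonarch_abs_def)

lemma v_0 [simp]: "v 0 = 0"
  by simp

lemma v_1 [simp]: "v 1 = 1"
  using v_mult[of 1 1] v_eq_0_iff[of 1] by auto

lemma v_pos: "x \<noteq> 0 \<Longrightarrow> v x > 0"
  using v_nonneg[of x] v_eq_0_iff[of x] by linarith

lemma v_power: "v (x ^ n) = v x ^ n"
  by (induction n) (simp_all add: v_mult)

lemma v_inverse: "v (inverse x) = inverse (v x)"
proof (cases "x = 0")
  case False
  then show ?thesis
    using v_mult[of x "inverse x"] by (simp add: field_simps)
qed simp

lemma v_divide: "v (x / y) = v x / v y"
  by (simp add: divide_inverse v_mult v_inverse)

lemma v_sum_le: "(\<And>i. i \<in> I \<Longrightarrow> v (f i) \<le> C) \<Longrightarrow> C \<ge> 0 \<Longrightarrow> v (\<Sum>i\<in>I. f i) \<le> C"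
proof (induction I rule: infinite_finite_induct)
  case (insert x I)
  then have "max (v (f x)) (v (\<Sum>i\<in>I. f i)) \<le> C"
    by simp
  then show ?case
    using insert(1,2) v_add[of "f x" "\<Sum>i\<in>I. f i"] by (simp del: max.bounded_iff)
qed simp_all

lemma coeff_ring_val_ring: "coeff_ring (val_ring v)"
  by unfold_locales
     (auto simp: val_ring_def v_mult mult_le_one intro: order.trans[OF v_add])

sublocale O: coeff_ring "val_ring v"
  by (rule coeff_ring_val_ring)

sublocale K: coeff_ring "UNIV :: 'k set"
  by (rule coeff_ring_UNIV)

sublocale incl: coeff_hom "val_ring v" UNIV id
  by unfold_locales auto

lemma generic_fiber: "r \<in> P1_reps (val_ring v) \<Longrightarrow> r \<in> P1_reps UNIV"
  using incl.rep_map_mem by simp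

definition vec_norm :: "'k \<times> 'k \<Rightarrow> real" where
  "vec_norm p = max (v (fst p)) (v (snd p))"

lemma vec_norm_scale: "vec_norm (vec_scale c p) = v c * vec_norm p"
  by (simp add: vec_norm_def vec_scale_def v_mult max_mult_distrib_left)

lemma form_eval_le:
  assumes "F \<in> poly_over (val_ring v)"
  shows "v (form_eval d F x y) \<le> max (v x) (v y) ^ d"
  unfolding form_eval_def
proof (rule v_sum_le)
  fix i assume i: "i \<in> {..d}"
  let ?M = "max (v x) (v y)"
  have "v (coeff F i * x ^ i * y ^ (d - i)) = v (coeff F i) * (v x ^ i * v y ^ (d - i))"
    by (simp add: v_mult v_power mult.assoc)
  also have "\<dots> \<le> 1 * (?M ^ i * ?M ^ (d - i))"
    using assms
    by (intro mult_mono power_mono) (auto simp: poly_over_def val_ring_def le_max_iff_disj)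
  also have "\<dots> = ?M ^ d"
    using i by (simp add: power_add[symmetric])
  finally show "v (coeff F i * x ^ i * y ^ (d - i)) \<le> ?M ^ d" .
qed (simp add: le_max_iff_disj)

lemma poly_le:
  assumes "p \<in> poly_over (val_ring v)" "v t \<le> 1"
  shows "v (poly p t) \<le> 1"
  using form_eval_le[OF assms(1), of "degree p" t 1] assms(2)
  by (simp add: form_eval_dehomogenize max_absorb2)

lemma unit_ideal_poly:
  assumes "p \<in> poly_over (val_ring v)" "q \<in> poly_over (val_ring v)"
    and "unit_ideal (val_ring v) p q" "v t \<le> 1"
  shows "max (v (poly p t)) (v (poly q t)) = 1"
proof -
  obtain a b where ab: "a \<in> poly_over (val_ring v)" "b \<in> poly_over (val_ring v)"
    "a * p + b * q = 1"
    using assms by (auto simp: unit_ideal_def)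
  have "1 = v (poly a t * poly p t + poly b t * poly q t)"
    using arg_cong[OF ab(3), of "\<lambda>p. v (poly p t)"] by simp
  also have "\<dots> \<le> max (v (poly a t) * v (poly p t)) (v (poly b t) * v (poly q t))"
    unfolding v_mult[symmetric] by (rule v_add)
  also have "\<dots> \<le> max (1 * v (poly p t)) (1 * v (poly q t))"
    by (intro max.mono mult_right_mono poly_le ab assms) auto
  finally show ?thesis
    using poly_le[OF assms(1,4)] poly_le[OF assms(2,4)] by simp
qed

text \<open>Scaling a coordinate of maximal absolute value to 1 moves a nonzero vector into one of the two standard
  charts with an integral parameter, where the Bezout relation prevents both values from being small.\<close>

lemma vec_norm_rep_eval:
  assumes r: "r \<in> P1_reps (val_ring v)" and p: "vec_norm p \<noteq> 0"
  shows "vec_norm (rep_eval r p) = vec_norm p ^ fst r"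
proof -
  obtain d F G where dFG: "r = (d, F, G)"
    by (metis prod_cases3)
  obtain x y where xy: "p = (x, y)"
    by (metis surj_pair)
  have FG: "F \<in> poly_over (val_ring v)" "G \<in> poly_over (val_ring v)"
    "unit_ideal (val_ring v) (form_subst d F [:0, 1:] 1) (form_subst d G [:0, 1:] 1)"
    "unit_ideal (val_ring v) (form_subst d F 1 [:0, 1:]) (form_subst d G 1 [:0, 1:])"
    using r by (auto simp: dFG P1_reps_def)
  have unit: "vec_norm (rep_eval r (s, t)) = 1" if "s = 1 \<and> v t \<le> 1 \<or> t = 1 \<and> v s \<le> 1" for s t
    using that unit_ideal_poly[OF _ _ FG(3), of s] unit_ideal_poly[OF _ _ FG(4), of t] FG
    by (auto simp: O.poly_over_intros poly_form_subst rep_eval_def vec_norm_def dFG)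
  have "\<exists>c s t. p = vec_scale c (s, t) \<and> (s = 1 \<and> v t \<le> 1 \<or> t = 1 \<and> v s \<le> 1)"
  proof (cases "v x \<le> v y")
    case True
    then have "y \<noteq> 0"
      using p by (auto simp: vec_norm_def xy)
    then have "p = vec_scale y (x / y, 1)" "v (x / y) \<le> 1"
      using True by (simp_all add: vec_scale_def xy v_divide v_pos divide_simps)
    then show ?thesis by blast
  next
    case False
    then have "x \<noteq> 0"
      by auto
    then have "p = vec_scale x (1, y / x)" "v (y / x) \<le> 1"
      using False by (simp_all add: vec_scale_def xy v_divide v_pos divide_simps)
    then show ?thesis by blast
  qed
  then obtain c s t where c: "p = vec_scale c (s, t)" "s = 1 \<and> v t \<le> 1 \<or> t = 1 \<and> v s \<le> 1"
    by blast
  have "vec_norm (s, t) = 1"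
    using c(2) by (auto simp: vec_norm_def)
  then show ?thesis
    by (simp add: c(1) rep_eval_vec_scale vec_norm_scale unit[OF c(2)] v_power)
qed

text \<open>Two models differ by a constant of the field, which must have absolute value 1 since both
  representatives preserve the norm of a vector of norm 1.\<close>

lemma model_unique:
  assumes r: "r \<in> P1_reps (val_ring v)" and s: "s \<in> P1_reps (val_ring v)"
    and eq: "mor UNIV r = mor UNIV s"
  shows "mor (val_ring v) r = mor (val_ring v) s"
proof -
  obtain c where c: "c \<noteq> 0" "s = rep_scale c r"
    using eq r s by (auto simp: K.mor_eq_iff generic_fiber P1_rel_UNIV_iff)
  have "vec_norm (1, 0) = 1"
    by (simp add: vec_norm_def)
  then have "1 = v c"
    using vec_norm_rep_eval[OF s, of "(1, 0)"] vec_norm_rep_eval[OF r, of "(1, 0)"]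
    by (simp add: c(2) rep_eval_scale vec_norm_scale)
  then have "c \<in> val_ring v" "inverse c \<in> val_ring v" "c * inverse c = 1"
    using c(1) by (simp_all add: val_ring_def v_inverse)
  then have "(r, s) \<in> P1_rel (val_ring v)"
    unfolding P1_rel_iff using r c(2) by blast
  then show ?thesis
    using r s by (simp add: O.mor_eq_iff)
qed

lemma good_model_iff:
  "good_model v \<phi> \<Phi> \<longleftrightarrow>
    (\<exists>r\<in>P1_reps (val_ring v). \<Phi> = mor (val_ring v) r \<and> \<phi> = mor UNIV r)"
  unfolding good_model_def
  using O.carrier_mor O.mor_carrier incl.base_change_mor by (metis rep_map_id)

lemma good_reduction_iff: "good_reduction v \<phi> \<longleftrightarrow> (\<exists>r\<in>P1_reps (val_ring v). \<phi> = mor UNIV r)"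
  by (auto simp: good_reduction_def good_model_iff)

text \<open>For \<open>A\<close> of degree 1 this is the operator norm of the matrix with respect to the maximum norm, which in
  the non-Archimedean setting is attained at a coordinate vector.\<close>

definition rep_size :: "nat \<times> 'k poly \<times> 'k poly \<Rightarrow> real" where
  "rep_size A = max (vec_norm (rep_eval A (1, 0))) (vec_norm (rep_eval A (0, 1)))"

lemma rep_size_scale: "rep_size (rep_scale c A) = v c * rep_size A"
  by (simp add: rep_size_def rep_eval_scale vec_norm_scale max_mult_distrib_left)

lemma vec_norm_linear:
  assumes "fst A = 1" "vec_norm p \<le> 1"
  shows "vec_norm (rep_eval A p) \<le> rep_size A"
proof -
  obtain A\<^sub>1 A\<^sub>2 where A: "A = (1, A\<^sub>1, A\<^sub>2)"
    using assms by (metis prod.collapse)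
  have "v (form_eval 1 F x y) \<le> max (v (coeff F 1)) (v (coeff F 0))" if "v x \<le> 1" "v y \<le> 1" for F x y
  proof -
    have "v (form_eval 1 F x y) \<le> max (v (coeff F 0) * v y) (v (coeff F 1) * v x)"
      unfolding form_eval_linear v_mult[symmetric] by (rule v_add)
    also have "\<dots> \<le> max (v (coeff F 0) * 1) (v (coeff F 1) * 1)"
      using that by (intro max.mono mult_left_mono) auto
    finally show ?thesis by (simp add: max.commute)
  qed
  from this[of "fst p" "snd p" A\<^sub>1] this[of "fst p" "snd p" A\<^sub>2] show ?thesis
    using assms(2)
    by (simp add: rep_size_def vec_norm_def rep_eval_def A form_eval_linear del: One_nat_def)
       (smt (verit, best))
qed

text \<open>Evaluate the commutation at a coordinate vector \<open>p\<close> where \<open>A\<close> attains its norm: the left-hand side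
  has norm \<open>|A p|^d\<close>, whereas \<open>\<Phi> p\<close> still has norm 1 and its image under \<open>A\<close> has norm at most that of \<open>A\<close>.\<close>

lemma rep_size_power_le:
  assumes \<Phi>: "\<Phi> \<in> P1_reps (val_ring v)" and A: "fst A = 1"
    and comm: "\<And>p. rep_eval \<Phi> (rep_eval A p) = vec_scale c (rep_eval A (rep_eval \<Phi> p))"
    and "rep_size A \<noteq> 0"
  shows "rep_size A ^ fst \<Phi> \<le> v c * rep_size A"
proof -
  obtain p where p: "vec_norm p = 1" "rep_size A = vec_norm (rep_eval A p)"
  proof (cases "vec_norm (rep_eval A (1, 0)) \<le> vec_norm (rep_eval A (0, 1))")
    case True
    then show thesis by (intro that[of "(0, 1)"]) (simp_all add: vec_norm_def rep_size_def max_absorb2)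
  next
    case False
    then show thesis by (intro that[of "(1, 0)"]) (simp_all add: vec_norm_def[of "(1, 0)"] rep_size_def)
  qed
  have "rep_size A ^ fst \<Phi> = vec_norm (rep_eval \<Phi> (rep_eval A p))"
    using p assms(4) by (simp add: vec_norm_rep_eval[OF \<Phi>])
  also have "\<dots> = v c * vec_norm (rep_eval A (rep_eval \<Phi> p))"
    by (simp add: comm vec_norm_scale)
  also have "\<dots> \<le> v c * rep_size A"
    using p by (intro mult_left_mono vec_norm_linear A) (simp_all add: vec_norm_rep_eval[OF \<Phi>])
  finally show ?thesis .
qed

text \<open>Both \<open>A\<close> and its inverse \<open>B\<close> satisfy the inequality above, with mutually inverse constants. Multiplying
  the two inequalities bounds the product of the norms by 1, which is what is needed to make both
  matrices integral by one scaling.\<close>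

lemma good_reduction_Aut:
  assumes \<Phi>: "\<Phi> \<in> P1_reps (val_ring v)" and d: "fst \<Phi> \<ge> 2"
    and f: "f \<in> carrier (P1_Aut UNIV (mor UNIV \<Phi>))"
  shows "good_reduction v f"
proof -
  obtain A B c where AB: "A \<in> P1_reps UNIV" "B \<in> P1_reps UNIV" "fst A = 1" "fst B = 1"
    and fA: "f = mor UNIV A" and inv: "rep_comp A B = rep_one" "rep_comp B A = rep_one"
    and c: "c \<noteq> 0" "rep_comp \<Phi> A = rep_scale c (rep_comp A \<Phi>)"
    using P1_Aut_rep[OF generic_fiber[OF \<Phi>] f] by metis
  have invA: "rep_eval A (rep_eval B p) = p" and invB: "rep_eval B (rep_eval A p) = p" for p
    using rep_eval_comp[OF AB(2), of A p] rep_eval_comp[OF AB(1), of B p] inv by simp_all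
  have commA: "rep_eval \<Phi> (rep_eval A p) = vec_scale c (rep_eval A (rep_eval \<Phi> p))" for p
    using rep_eval_comp[OF AB(1), of \<Phi> p] rep_eval_comp[OF generic_fiber[OF \<Phi>], of A p] c(2)
    by (simp add: rep_eval_scale)
  have commB: "rep_eval \<Phi> (rep_eval B p) = vec_scale (inverse c) (rep_eval B (rep_eval \<Phi> p))" for p
  proof -
    have "vec_scale (inverse c) (rep_eval B (rep_eval \<Phi> p)) =
        vec_scale (inverse c) (rep_eval B (rep_eval \<Phi> (rep_eval A (rep_eval B p))))"
      by (simp add: invA)
    also have "\<dots> = vec_scale (inverse c) (vec_scale c (rep_eval \<Phi> (rep_eval B p)))"
      unfolding commA rep_eval_vec_scale AB invB by simp
    finally show ?thesis
      using c(1) by (simp add: vec_scale_def mult.assoc[symmetric])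
  qed
  have size_pos: "rep_size C > 0" if "rep_eval D (rep_eval C (1, 0)) = (1, 0)" "fst D = 1" for C D
  proof -
    have "rep_eval C (1, 0) \<noteq> vec_scale 0 (1, 0)"
      using that rep_eval_vec_scale[of D 0 "(1, 0)"] by (auto simp: vec_scale_def)
    then show ?thesis
      by (auto simp: rep_size_def vec_norm_def vec_scale_def prod_eq_iff less_max_iff_disj
          intro: v_pos)
  qed
  have pos: "rep_size A > 0" "rep_size B > 0"
    using size_pos invA invB AB by blast+
  have "(rep_size A * rep_size B) ^ fst \<Phi> \<le> (v c * rep_size A) * (v (inverse c) * rep_size B)"
    unfolding power_mult_distrib
    using pos by (intro mult_mono rep_size_power_le \<Phi> AB commA commB) auto
  also have "\<dots> = (rep_size A * rep_size B) ^ 1"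
    using c(1) by (simp add: v_inverse)
  finally have le1: "rep_size A * rep_size B \<le> 1"
    using d power_le_imp_le_exp[of "rep_size A * rep_size B" "fst \<Phi>" 1] by fastforce
  have "rep_size A \<in> range v"
    by (auto simp: rep_size_def vec_norm_def max_def)
  then obtain u where u: "v u = rep_size A"
    by auto
  then have "u \<noteq> 0"
    using pos by auto
  define A' B' where "A' = rep_scale (inverse u) A" and "B' = rep_scale u B"
  obtain A\<^sub>1 A\<^sub>2 B\<^sub>1 B\<^sub>2 where A'B': "A' = (1, A\<^sub>1, A\<^sub>2)" "B' = (1, B\<^sub>1, B\<^sub>2)"
    using AB by (cases A, cases B) (auto simp: A'_def B'_def rep_scale_def)
  have deg: "degree A\<^sub>1 \<le> 1" "degree A\<^sub>2 \<le> 1" "degree B\<^sub>1 \<le> 1" "degree B\<^sub>2 \<le> 1"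
  proof -
    have "A' \<in> P1_reps UNIV" "B' \<in> P1_reps UNIV"
      unfolding A'_def B'_def using AB \<open>u \<noteq> 0\<close>
      by (auto intro: K.rep_scale_mem[of _ u "inverse u"] K.rep_scale_mem[of _ "inverse u" u])
    then show "degree A\<^sub>1 \<le> 1" "degree A\<^sub>2 \<le> 1" "degree B\<^sub>1 \<le> 1" "degree B\<^sub>2 \<le> 1"
      by (auto simp: A'B' P1_reps_def)
  qed
  have "rep_size A' = 1" "rep_size B' \<le> 1"
    using le1 pos by (simp_all add: A'_def B'_def rep_size_scale u v_inverse)
  have integral: "C\<^sub>1 \<in> poly_over (val_ring v) \<and> C\<^sub>2 \<in> poly_over (val_ring v)"
    if "rep_size (1, C\<^sub>1, C\<^sub>2) \<le> 1" "degree C\<^sub>1 \<le> 1" "degree C\<^sub>2 \<le> 1" for C\<^sub>1 C\<^sub>2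
  proof -
    have "v (coeff C i) \<le> 1" if "v (coeff C 0) \<le> 1" "v (coeff C 1) \<le> 1" "degree C \<le> 1" for C i
    proof (cases "i = 0 \<or> i = 1")
      case False
      then show ?thesis
        using that by (simp add: coeff_eq_0)
    qed (use that in auto)
    with that show ?thesis
      by (simp add: poly_over_def val_ring_def rep_size_def vec_norm_def rep_eval_def form_eval_linear
          del: One_nat_def)
  qed
  have "rep_comp B' A' = rep_one"
    using \<open>u \<noteq> 0\<close> by (simp add: A'_def B'_def rep_comp_scale AB inv)
  then have "A' \<in> P1_reps (val_ring v)"
    unfolding A'B' using deg integral[of A\<^sub>1 A\<^sub>2] integral[of B\<^sub>1 B\<^sub>2]
      \<open>rep_size A' = 1\<close> \<open>rep_size B' \<le> 1\<close>
    by (intro O.rep_mem_if_left_inverse[where B\<^sub>1 = B\<^sub>1 and B\<^sub>2 = B\<^sub>2]) (simp_all add: A'B')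
  moreover have "(A, A') \<in> P1_rel UNIV"
    unfolding P1_rel_UNIV_iff A'_def using AB(1) \<open>u \<noteq> 0\<close> nonzero_imp_inverse_nonzero by blast
  ultimately show ?thesis
    unfolding good_reduction_iff fA using AB(1) generic_fiber K.mor_eq_iff by blast
qed

end

section \<open>Powers of a matrix\<close>

text \<open>
  The representative \<open>(1, [:b, a:], [:d, c:])\<close> corresponds to the matrix with rows \<open>(a, b)\<close> and \<open>(c, d)\<close>, and
  \<open>rep_lin A s t\<close> to the matrix \<open>s A + t\<close>.\<close>

definition rep_lin :: "nat \<times> 'a::comm_ring_1 poly \<times> 'a poly \<Rightarrow> 'a \<Rightarrow> 'a \<Rightarrow> nat \<times> 'a poly \<times> 'a poly" where
  "rep_lin A s t = (case A of (d, A\<^sub>1, A\<^sub>2) \<Rightarrow> (1, smult s A\<^sub>1 + [:0, t:], smult s A\<^sub>2 + [:t:]))"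

definition rep_pow :: "nat \<times> 'a::comm_ring_1 poly \<times> 'a poly \<Rightarrow> nat \<Rightarrow> nat \<times> 'a poly \<times> 'a poly" where
  "rep_pow A m = (rep_comp A ^^ m) rep_one"

text \<open>The coefficients \<open>s, t\<close> in \<open>A^m = s A + t\<close> for a matrix of trace \<open>\<tau>\<close> and determinant \<open>\<delta>\<close>, as determined
  by \<open>A^2 = \<tau> A - \<delta>\<close>.\<close>

primrec cayley :: "'a::comm_ring_1 \<Rightarrow> 'a \<Rightarrow> nat \<Rightarrow> 'a \<times> 'a" where
  "cayley \<tau> \<delta> 0 = (0, 1)"
| "cayley \<tau> \<delta> (Suc m) =
    (fst (cayley \<tau> \<delta> m) * \<tau> + snd (cayley \<tau> \<delta> m), - fst (cayley \<tau> \<delta> m) * \<delta>)"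

lemma rep_pow_cayley:
  "rep_pow (1, [:b, a:], [:d, c:]) m =
    rep_lin (1, [:b, a:], [:d, c:])
      (fst (cayley (a + d) (a * d - b * c) m)) (snd (cayley (a + d) (a * d - b * c) m))"
proof (induction m)
  case 0
  show ?case
    by (simp add: rep_pow_def rep_lin_def rep_one_def one_pCons)
next
  case (Suc m)
  have "rep_comp (1, [:b, a:], [:d, c:]) (rep_lin (1, [:b, a:], [:d, c:]) s t) =
      rep_lin (1, [:b, a:], [:d, c:]) (s * (a + d) + t) (- s * (a * d - b * c))" for s t
    by (simp add: rep_comp_def rep_lin_def form_subst_linear algebra_simps del: One_nat_def)
       (simp add: algebra_simps)
  with Suc show ?case
    by (simp add: rep_pow_def)
qed

lemma rep_lin_scalar_iff:
  "rep_lin (1, [:b, a:], [:d, c:]) s t = rep_scale u rep_one \<longleftrightarrow>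
    s * b = 0 \<and> s * c = 0 \<and> s * a + t = u \<and> s * d + t = u"
  by (auto simp: rep_lin_def rep_scale_def rep_one_def)

lemma (in coeff_ring) rep_pow_mem: "A \<in> P1_reps R \<Longrightarrow> rep_pow A m \<in> P1_reps R"
  by (induction m) (simp_all add: rep_pow_def rep_one_mem rep_comp_mem)

lemma mor_rep_scale_one:
  fixes u :: "'a::field"
  assumes "rep_scale u rep_one \<in> P1_reps UNIV"
  shows "mor UNIV (rep_scale u rep_one) = \<one>\<^bsub>P1_End UNIV\<^esub>"
proof -
  interpret R: coeff_ring "UNIV :: 'a set"
    by (rule coeff_ring_UNIV)
  have "u \<noteq> 0"
    using rep_scale_cancel[OF assms, of 0] by (auto simp: rep_scale_scale)
  then have "(rep_one, rep_scale u rep_one) \<in> P1_rel UNIV"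
    unfolding P1_rel_UNIV_iff using R.rep_one_mem by blast
  then show ?thesis
    using assms by (metis R.mor_eq_iff R.mor_one R.rep_one_mem)
qed

lemma rep_degree_1_cases:
  assumes "A \<in> P1_reps R" "fst A = 1"
  obtains a b c d where "A = (1, [:b, a:], [:d, c:])"
proof -
  have lin: "p = [:coeff p 0, coeff p 1:]" if "degree p \<le> 1" for p :: "'a poly"
    using that by (auto simp: poly_eq_iff coeff_pCons coeff_eq_0 split: nat.split)
  obtain A\<^sub>1 A\<^sub>2 where "A = (1, A\<^sub>1, A\<^sub>2)" "degree A\<^sub>1 \<le> 1" "degree A\<^sub>2 \<le> 1"
    using assms by (cases A) (auto simp: P1_reps_def)
  then show thesis
    using that lin by metis
qed

section \<open>Automorphisms have finite order\<close>

definition det2 :: "'a::comm_ring_1 \<times> 'a \<Rightarrow> 'a \<times> 'a \<Rightarrow> 'a" where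
  "det2 p q = fst p * snd q - snd p * fst q"

text \<open>Points with nonzero second coordinate give distinct roots of the dehomogenized polynomial. At most one
  point lies at infinity, and a zero there lowers the bound on the degree by one.\<close>

lemma form_eq_0_if_zeros:
  fixes p :: "'a::field poly"
  assumes "degree p \<le> n"
    and zeros: "\<And>i. i \<le> n \<Longrightarrow> form_eval n p (fst (z i)) (snd (z i)) = 0"
    and distinct: "\<And>i j. i < j \<Longrightarrow> j \<le> n \<Longrightarrow> det2 (z i) (z j) \<noteq> 0"
    and "n > 0"
  shows "p = 0"
proof (rule ccontr)
  assume p: "p \<noteq> 0"
  define I where "I = {i. i \<le> n \<and> snd (z i) \<noteq> 0}"
  define w where "w i = fst (z i) / snd (z i)" for i
  have det: "det2 (z i) (z j) \<noteq> 0" if "i \<noteq> j" "i \<le> n" "j \<le> n" for i j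
    using distinct[of i j] distinct[of j i] that
    by (cases "i < j") (auto simp: det2_def mult.commute)
  have inj: "inj_on w I"
  proof (rule inj_onI)
    fix i j assume "i \<in> I" "j \<in> I" "w i = w j"
    then have "det2 (z i) (z j) = 0"
      by (simp add: I_def w_def det2_def divide_simps)
    then show "i = j"
      using det \<open>i \<in> I\<close> \<open>j \<in> I\<close> by (auto simp: I_def)
  qed
  have root: "poly p (w i) = 0" if "i \<in> I" for i
  proof -
    have "snd (z i) ^ n * form_eval n p (w i) 1 = 0"
      using form_eval_scale[of n p "snd (z i)" "w i" 1] zeros[of i] that by (simp add: I_def w_def)
    then show ?thesis
      using that by (simp add: I_def form_eval_dehomogenize assms(1))
  qed
  have "finite I"
    by (simp add: I_def)
  have "card I = card (w ` I)"
    using inj by (simp add: card_image)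
  also have "\<dots> \<le> card {x. poly p x = 0}"
    using root p by (intro card_mono poly_roots_finite) auto
  also have "\<dots> \<le> degree p"
    using p by (rule card_poly_roots_bound)
  finally have card_le: "card I \<le> degree p" .
  show False
  proof (cases "\<exists>i\<le>n. snd (z i) = 0")
    case True
    then obtain i where i: "i \<le> n" "snd (z i) = 0"
      by blast
    then have "I = {..n} - {i}"
      using det[of i] by (fastforce simp: I_def det2_def)
    then have "card I = n"
      using i by simp
    moreover have "fst (z i) \<noteq> 0"
    proof -
      obtain j where "j \<le> n" "j \<noteq> i"
        using \<open>n > 0\<close> by (cases "i = 0") auto
      then show ?thesis
        using det[of i j] i by (auto simp: det2_def)
    qed
    then have "coeff p n = 0"
      using form_eval_scale[of n p "fst (z i)" 1 0] zeros[of i] i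
      by (simp add: form_eval_def power_0_left if_distrib[of "\<lambda>x. _ * x"] cong: if_cong)
    then have "degree p < n"
      using p assms(1) by (metis le_neq_implies_less leading_coeff_0_iff)
    ultimately show False
      using card_le by simp
  next
    case False
    then have "I = {..n}"
      by (auto simp: I_def)
    then show False
      using card_le assms(1) by simp
  qed
qed

text \<open>By coprimality \<open>(L\<^sub>1, L\<^sub>2)\<close> is a multiple of \<open>(F, G)\<close>, and one of \<open>F\<close>, \<open>G\<close> has degree exactly \<open>d\<close>,
  because the two forms have no common zero at infinity.\<close>

lemma no_linear_syzygy:
  fixes F G :: "'a::field poly"
  assumes r: "(d, F, G) \<in> P1_reps UNIV" and d: "d \<ge> 2"
    and deg: "degree L\<^sub>1 \<le> 1" "degree L\<^sub>2 \<le> 1" and eq: "F * L\<^sub>2 = G * L\<^sub>1"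
  shows "L\<^sub>1 = 0" "L\<^sub>2 = 0"
proof -
  have FG: "degree F \<le> d" "degree G \<le> d" "unit_ideal UNIV F G"
    "unit_ideal UNIV (form_subst d F 1 [:0, 1:]) (form_subst d G 1 [:0, 1:])"
    using r by (auto simp: P1_reps_def form_subst_ident)
  have at_0: "poly (form_subst d H 1 [:0, 1:]) 0 = coeff H d" for H :: "'a poly"
    by (simp add: poly_form_subst form_eval_def power_0_left if_distrib[of "\<lambda>x. _ * x"] cong: if_cong)
  obtain a b where "a * form_subst d F 1 [:0, 1:] + b * form_subst d G 1 [:0, 1:] = 1"
    using FG(4) by (auto simp: unit_ideal_def)
  from arg_cong[OF this, of "\<lambda>p. poly p 0"] have "coeff F d \<noteq> 0 \<or> coeff G d \<noteq> 0"
    by (auto simp: at_0)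
  then have dFG: "degree F = d \<or> degree G = d"
    using FG(1,2) le_degree by (metis le_antisym)
  obtain \<alpha> \<beta> where ab: "\<alpha> * F + \<beta> * G = 1"
    using FG(3) by (auto simp: unit_ideal_def)
  define K where "K = \<alpha> * L\<^sub>1 + \<beta> * L\<^sub>2"
  have "L\<^sub>1 = (\<alpha> * F + \<beta> * G) * L\<^sub>1" "L\<^sub>2 = (\<alpha> * F + \<beta> * G) * L\<^sub>2"
    by (simp_all add: ab)
  moreover have "(\<alpha> * F + \<beta> * G) * L\<^sub>1 = \<alpha> * F * L\<^sub>1 + \<beta> * (F * L\<^sub>2)"
    unfolding eq by (simp add: algebra_simps)
  moreover have "(\<alpha> * F + \<beta> * G) * L\<^sub>2 = \<alpha> * (G * L\<^sub>1) + \<beta> * G * L\<^sub>2"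
    unfolding eq[symmetric] by (simp add: algebra_simps)
  ultimately have L: "L\<^sub>1 = F * K" "L\<^sub>2 = G * K"
    by (simp_all add: K_def algebra_simps)
  have "K = 0"
  proof (rule ccontr)
    assume K: "K \<noteq> 0"
    from dFG show False
    proof
      assume "degree F = d"
      then have "degree L\<^sub>1 \<ge> d"
        using K d unfolding L by (subst degree_mult_eq) auto
      then show False
        using deg d by simp
    next
      assume "degree G = d"
      then have "degree L\<^sub>2 \<ge> d"
        using K d unfolding L by (subst degree_mult_eq) auto
      then show False
        using deg d by simp
    qed
  qed
  then show "L\<^sub>1 = 0" "L\<^sub>2 = 0"
    by (simp_all add: L)
qed

text \<open>If no positive power of \<open>A\<close> is scalar, all coefficients \<open>s\<close> in \<open>A^m = s A + t\<close> with \<open>m > 0\<close> are nonzero,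
  and a point that is not fixed by \<open>A\<close> has an infinite orbit, since
  \<open>det(A^i z, A^(i + j) z) = \<delta>^i s\<^sub>j det(z, A z)\<close>. The forms \<open>P = det(\<Phi>, A x)\<close> and
  \<open>Q = det(\<Phi>, x)\<close> have the same multiplier \<open>\<mu> \<delta>\<close> along this orbit, so that \<open>Q(z) P - P(z) Q\<close> vanishes on
  it and is therefore zero. This is a relation \<open>F L\<^sub>2 = G L\<^sub>1\<close> with linear forms \<open>L\<^sub>1\<close> and \<open>L\<^sub>2\<close>, whose vanishing
  makes \<open>A\<close> scalar.\<close>

lemma commuting_imp_finite_order:
  fixes \<Phi> A B :: "nat \<times> 'a::field poly \<times> 'a poly"
  assumes \<Phi>: "\<Phi> \<in> P1_reps UNIV" "fst \<Phi> \<ge> 2"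
    and A: "A \<in> P1_reps UNIV" "fst A = 1" and B: "B \<in> P1_reps UNIV" "fst B = 1"
    and inv: "rep_comp B A = rep_one"
    and comm: "rep_comp \<Phi> A = rep_scale \<mu> (rep_comp A \<Phi>)"
    and inf: "infinite (UNIV :: 'a set)"
  shows "\<exists>m>0. \<exists>u. rep_pow A m = rep_scale u rep_one"
proof -
  obtain a b c e where Aeq: "A = (1, [:b, a:], [:e, c:])"
    using rep_degree_1_cases[OF A] by metis
  obtain d F G where \<Phi>eq: "\<Phi> = (d, F, G)"
    by (metis prod_cases3)
  have d: "d \<ge> 2" and FG: "degree F \<le> d" "degree G \<le> d"
    using \<Phi> by (auto simp: \<Phi>eq P1_reps_def)
  define \<delta> where "\<delta> = a * e - b * c"
  define s where "s m = fst (cayley (a + e) \<delta> m)" for m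
  define t where "t m = snd (cayley (a + e) \<delta> m)" for m
  have pow: "rep_pow A m = rep_lin A (s m) (t m)" for m
    unfolding Aeq s_def t_def \<delta>_def by (rule rep_pow_cayley)
  have evA: "rep_eval A p = (b * snd p + a * fst p, e * snd p + c * fst p)" for p
    by (simp add: Aeq rep_eval_def form_eval_pCons del: One_nat_def)
  have det_A: "det2 (rep_eval A p) (rep_eval A q) = \<delta> * det2 p q" for p q
    by (simp add: evA det2_def \<delta>_def algebra_simps)
  have "\<delta> \<noteq> 0"
  proof
    assume "\<delta> = 0"
    obtain b' a' e' c' where Beq: "B = (1, [:b', a':], [:e', c':])"
      using rep_degree_1_cases[OF B] by metis
    have "det2 (rep_eval B p) (rep_eval B q) = (a' * e' - b' * c') * det2 p q" for p q
      by (simp add: Beq rep_eval_def form_eval_pCons det2_def algebra_simps del: One_nat_def)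
    from this[of "rep_eval A (1, 0)" "rep_eval A (0, 1)"] show False
      using \<open>\<delta> = 0\<close> by (simp add: rep_eval_comp[OF A(1), symmetric] inv det_A) (simp add: det2_def)
  qed
  show ?thesis
  proof (rule ccontr)
    assume no: "\<not> ?thesis"
    have s_nz: "s m \<noteq> 0" if "m > 0" for m
    proof
      assume "s m = 0"
      then have "rep_pow A m = rep_scale (t m) rep_one"
        unfolding pow unfolding Aeq rep_lin_scalar_iff by simp
      then show False
        using no that by blast
    qed
    \<comment> \<open>The roots of \<open>W\<close> are the finite fixed points of \<open>A\<close>, those of \<open>Q\<close> the finite fixed points of \<open>\<Phi>\<close>.\<close>
    define W where "W = [:e, c:] * [:0, 1:] - [:b, a:]"
    define P where "P = F * [:e, c:] - G * [:b, a:]"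
    define Q where "Q = F * 1 - G * [:0, 1:]"
    have evP: "form_eval (d + 1) P x y = det2 (rep_eval \<Phi> (x, y)) (rep_eval A (x, y))" for x y
      unfolding P_def form_eval_diff
      by (subst (1 2) form_eval_mult) (use FG in \<open>simp_all add: \<Phi>eq Aeq rep_eval_def det2_def\<close>)
    have evQ: "form_eval (d + 1) Q x y = det2 (rep_eval \<Phi> (x, y)) (x, y)" for x y
      unfolding Q_def form_eval_diff
      by (subst (1 2) form_eval_mult)
         (use FG in \<open>simp_all add: \<Phi>eq rep_eval_def det2_def form_eval_def\<close>)
    have "W \<noteq> 0"
    proof
      assume "W = 0"
      then have "b = 0" "c = 0" "a = e"
        by (auto simp: W_def)
      then have "rep_pow A 1 = rep_scale a rep_one"
        unfolding pow unfolding Aeq rep_lin_scalar_iff by (simp add: s_def t_def)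
      then show False
        using no by blast
    qed
    moreover have "Q \<noteq> 0"
      using no_linear_syzygy(2)[of d F G "[:0, 1:]" 1] \<Phi>(1) d by (auto simp: Q_def \<Phi>eq)
    ultimately have "finite {x. poly (W * Q) x = 0}"
      by (intro poly_roots_finite) simp
    then have "{x. poly (W * Q) x = 0} \<noteq> UNIV"
      using inf by metis
    \<comment> \<open>The starting point: neither a fixed point of \<open>A\<close> nor one of \<open>\<Phi>\<close>.\<close>
    then obtain x where x: "poly W x \<noteq> 0" "poly Q x \<noteq> 0"
      by auto
    define z where "z j = (rep_eval A ^^ j) (x, 1)" for j
    have z_Suc: "z (Suc j) = rep_eval A (z j)" for j
      by (simp add: z_def)
    have z_pow: "z j = rep_eval (rep_pow A j) (x, 1)" for j
      by (induction j)
         (simp_all add: z_def rep_pow_def rep_eval_comp[OF coeff_ring.rep_pow_mem[OF coeff_ring_UNIV A(1)], unfolded rep_pow_def])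
    have det_z0: "det2 (z 0) (z j) = s j * poly W x" for j
      unfolding z_pow[of j] pow
      by (simp add: z_def Aeq rep_lin_def rep_eval_def form_eval_pCons det2_def W_def algebra_simps del: One_nat_def)
    have det_z: "det2 (z i) (z (i + j)) = \<delta> ^ i * det2 (z 0) (z j)" for i j
      by (induction i) (simp_all add: z_Suc det_A mult_ac)
    have distinct: "det2 (z i) (z j) \<noteq> 0" if "i < j" for i j
      using det_z[of i "j - i"] that \<open>\<delta> \<noteq> 0\<close> x s_nz[of "j - i"] by (simp add: det_z0)
    have comm_eval: "rep_eval \<Phi> (rep_eval A p) = vec_scale \<mu> (rep_eval A (rep_eval \<Phi> p))" for p
      using comm rep_eval_comp[OF A(1), of \<Phi> p] rep_eval_comp[OF \<Phi>(1), of A p]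
      by (simp add: rep_eval_scale)
    have det_scale: "det2 (vec_scale u p) q = u * det2 p q" for u p q
      by (simp add: det2_def vec_scale_def algebra_simps)
    define p\<^sub>0 q\<^sub>0 where "p\<^sub>0 = form_eval (d + 1) P x 1" and "q\<^sub>0 = form_eval (d + 1) Q x 1"
    have P_z: "form_eval (d + 1) P (fst (z j)) (snd (z j)) = (\<mu> * \<delta>) ^ j * p\<^sub>0"
      and Q_z: "form_eval (d + 1) Q (fst (z j)) (snd (z j)) = (\<mu> * \<delta>) ^ j * q\<^sub>0" for j
    proof (induction j)
      case 0
      show "form_eval (d + 1) P (fst (z 0)) (snd (z 0)) = (\<mu> * \<delta>) ^ 0 * p\<^sub>0"
        "form_eval (d + 1) Q (fst (z 0)) (snd (z 0)) = (\<mu> * \<delta>) ^ 0 * q\<^sub>0"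
        by (simp_all add: z_def p\<^sub>0_def q\<^sub>0_def)
    next
      case (Suc j)
      then show "form_eval (d + 1) P (fst (z (Suc j))) (snd (z (Suc j))) = (\<mu> * \<delta>) ^ Suc j * p\<^sub>0"
        "form_eval (d + 1) Q (fst (z (Suc j))) (snd (z (Suc j))) = (\<mu> * \<delta>) ^ Suc j * q\<^sub>0"
        unfolding evP evQ by (simp_all add: z_Suc comm_eval det_scale det_A mult_ac)
    qed
    define H where "H = smult q\<^sub>0 P - smult p\<^sub>0 Q"
    have degPQ: "degree P \<le> d + 1" "degree Q \<le> d + 1"
      unfolding P_def Q_def using FG
      by (auto intro!: degree_diff_le order.trans[OF degree_mult_le] add_mono
          simp del: mult_pCons_left mult_pCons_right)
    have "H = 0"
    proof (rule form_eq_0_if_zeros[where n = "d + 1" and z = z])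
      show "degree H \<le> d + 1"
        unfolding H_def using degPQ by (meson degree_diff_le degree_smult_le order.trans)
    qed (simp_all add: H_def form_eval_diff form_eval_smult P_z Q_z distinct mult_ac del: One_nat_def)
    moreover have "F * (smult q\<^sub>0 A\<^sub>2 - smult p\<^sub>0 1) - G * (smult q\<^sub>0 A\<^sub>1 - smult p\<^sub>0 X) =
        smult q\<^sub>0 (F * A\<^sub>2 - G * A\<^sub>1) - smult p\<^sub>0 (F * 1 - G * X)" for A\<^sub>1 A\<^sub>2 X
      by (simp add: algebra_simps smult_diff_right)
    ultimately have "F * (smult q\<^sub>0 [:e, c:] - smult p\<^sub>0 1) =
        G * (smult q\<^sub>0 [:b, a:] - smult p\<^sub>0 [:0, 1:])"
      unfolding H_def P_def Q_def by (metis eq_iff_diff_eq_0)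
    moreover have "degree (smult q\<^sub>0 [:b, a:] - smult p\<^sub>0 [:0, 1:]) \<le> 1"
      "degree (smult q\<^sub>0 [:e, c:] - smult p\<^sub>0 1) \<le> 1"
      by (intro degree_diff_le order.trans[OF degree_smult_le]; simp)+
    ultimately have L: "smult q\<^sub>0 [:b, a:] - smult p\<^sub>0 [:0, 1:] = 0" "smult q\<^sub>0 [:e, c:] - smult p\<^sub>0 1 = 0"
      using no_linear_syzygy[OF \<Phi>(1)[unfolded \<Phi>eq] d] by blast+
    have "q\<^sub>0 \<noteq> 0"
      using x(2) form_eval_dehomogenize[OF degPQ(2)] by (simp add: q\<^sub>0_def)
    moreover have "smult q\<^sub>0 W = 0"
      using L by (simp add: W_def algebra_simps)
    ultimately show False
      using \<open>W \<noteq> 0\<close> by simp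
  qed
qed

section \<open>Reduction of automorphisms\<close>

lemma fst_rep_map [simp]: "fst (rep_map h r) = fst r"
  by (simp add: rep_map_def split: prod.split)

context nonarch
begin

lemma v_uminus: "v (- x) = v x"
proof -
  have "v (- 1) ^ 2 = 1"
    by (simp flip: v_power)
  then have "v (- 1) = 1"
    using v_nonneg[of "- 1"] by (simp add: power2_eq_1_iff)
  then show ?thesis
    using v_mult[of "- 1" x] by simp
qed

lemma v_trivial_if_finite:
  assumes "finite (UNIV :: 'k set)" "x \<noteq> 0"
  shows "v x = 1"
proof -
  have "\<not> inj (\<lambda>n :: nat. x ^ n)"
    using assms(1) finite_imageD[of "\<lambda>n. x ^ n" "UNIV :: nat set"] infinite_UNIV_nat
    by (meson finite_subset subset_UNIV)
  then obtain i j :: nat where ij: "i < j" "x ^ i = x ^ j"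
    unfolding inj_def by (metis linorder_neqE_nat)
  have "x ^ j = x ^ i * x ^ (j - i)"
    using ij(1) by (simp add: power_add[symmetric])
  then have "x ^ (j - i) = 1"
    using ij(2) assms(2) by simp
  then have "v x ^ (j - i) = 1"
    by (simp flip: v_power)
  then show ?thesis
    using ij(1) power_eq_iff_eq_base[of "j - i" "v x" 1] by simp
qed

end

locale residue = nonarch v for v :: "'k::field \<Rightarrow> real" +
  fixes res :: "'k \<Rightarrow> 'f::field"
  assumes residue: "residue_map v res"
begin

lemma res_eq_0_iff: "x \<in> val_ring v \<Longrightarrow> res x = 0 \<longleftrightarrow> v x < 1"
  using residue by (auto simp: residue_map_def)

sublocale F: coeff_ring "UNIV :: 'f set"
  by (rule coeff_ring_UNIV)

sublocale red: coeff_hom "val_ring v" UNIV res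
  using residue res_eq_0_iff[of 0] by unfold_locales (auto simp: residue_map_def)

lemma res_uminus:
  assumes "x \<in> val_ring v"
  shows "- x \<in> val_ring v" "res (- x) = - res x"
proof -
  show "- x \<in> val_ring v"
    using assms by (simp add: val_ring_def v_uminus)
  then show "res (- x) = - res x"
    using red.hom_add[of x "- x"] assms by (simp add: eq_neg_iff_add_eq_0 add.commute)
qed

lemma reduction_mor:
  assumes "r \<in> P1_reps (val_ring v)"
  shows "reduction v res (mor UNIV r) = mor UNIV (rep_map res r)"
proof -
  have "(THE \<Phi>. good_model v (mor UNIV r) \<Phi>) = mor (val_ring v) r"
  proof (rule the_equality)
    show "good_model v (mor UNIV r) (mor (val_ring v) r)"
      using assms good_model_iff by blast
    show "\<Psi> = mor (val_ring v) r" if "good_model v (mor UNIV r) \<Psi>" for \<Psi>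
      using that assms model_unique unfolding good_model_iff by metis
  qed
  then show ?thesis
    using assms by (simp add: reduction_def red.base_change_mor)
qed

lemma reduction_one: "reduction v res \<one>\<^bsub>P1_End UNIV\<^esub> = \<one>\<^bsub>P1_End UNIV\<^esub>"
  by (simp add: K.mor_one F.mor_one reduction_mor O.rep_one_mem red.rep_map_one)

lemma reduction_mult:
  assumes "good_reduction v f" "good_reduction v g"
  shows "reduction v res (f \<otimes>\<^bsub>P1_End UNIV\<^esub> g) =
    reduction v res f \<otimes>\<^bsub>P1_End UNIV\<^esub> reduction v res g"
proof -
  obtain r s where "r \<in> P1_reps (val_ring v)" "f = mor UNIV r"
    "s \<in> P1_reps (val_ring v)" "g = mor UNIV s"
    using assms by (auto simp: good_reduction_iff)
  then show ?thesis
    by (simp add: K.mor_comp F.mor_comp generic_fiber reduction_mor O.rep_comp_mem red.rep_map_mem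
        red.rep_map_comp)
qed

lemma reduction_carrier: "good_reduction v f \<Longrightarrow> reduction v res f \<in> carrier (P1_End UNIV)"
  by (auto simp: good_reduction_iff reduction_mor red.rep_map_mem F.mor_carrier)

text \<open>If the trace and determinant of \<open>A\<close> reduce to those of the scalar matrix \<open>\<gamma>\<close>, then \<open>A^m = s A + t\<close> with
  \<open>s\<close> and \<open>t\<close> reducing to the coefficients of the linearization of \<open>z^m\<close> at \<open>z = \<gamma>\<close>, the remainder of
  \<open>z^m\<close> modulo \<open>(z - \<gamma>)^2\<close>. The exponent is shifted by one to avoid \<open>\<gamma>^(m - 1)\<close> at \<open>m = 0\<close>.\<close>

lemma res_cayley:
  assumes "\<tau> \<in> val_ring v" "\<delta> \<in> val_ring v" "res \<tau> = \<gamma> + \<gamma>" "res \<delta> = \<gamma> * \<gamma>"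
  shows "fst (cayley \<tau> \<delta> (Suc m)) \<in> val_ring v \<and> snd (cayley \<tau> \<delta> (Suc m)) \<in> val_ring v \<and>
    res (fst (cayley \<tau> \<delta> (Suc m))) = of_nat (Suc m) * \<gamma> ^ m \<and>
    res (snd (cayley \<tau> \<delta> (Suc m))) = - (of_nat m * \<gamma> ^ Suc m)"
proof (induction m)
  case (Suc m)
  define s t where "s = fst (cayley \<tau> \<delta> (Suc m))" and "t = snd (cayley \<tau> \<delta> (Suc m))"
  have st: "s \<in> val_ring v" "t \<in> val_ring v"
    "res s = of_nat (Suc m) * \<gamma> ^ m" "res t = - (of_nat m * \<gamma> ^ Suc m)"
    using Suc by (simp_all only: s_def t_def)
  have next_eq: "cayley \<tau> \<delta> (Suc (Suc m)) = (s * \<tau> + t, - (s * \<delta>))"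
    by (subst cayley.simps(2)) (simp only: s_def t_def mult_minus_left)
  show ?case
    unfolding next_eq using st assms
    by (simp add: res_uminus red.hom_add red.hom_mult O.add_mem O.mult_mem algebra_simps)
qed simp

text \<open>The reduction of an integral matrix representing \<open>f\<close> represents the identity, so it is a scalar matrix.\<close>

lemma trivial_reduction_rep:
  assumes "good_reduction v f" "reduction v res f = \<one>\<^bsub>P1_End UNIV\<^esub>"
  obtains a b c d \<gamma> where "(1, [:b, a:], [:d, c:]) \<in> P1_reps (val_ring v)"
    "f = mor UNIV (1, [:b, a:], [:d, c:])" "a \<in> val_ring v" "b \<in> val_ring v"
    "c \<in> val_ring v" "d \<in> val_ring v" "res a = \<gamma>" "res d = \<gamma>" "res b = 0" "res c = 0" "\<gamma> \<noteq> 0"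
proof -
  obtain A where A: "A \<in> P1_reps (val_ring v)" "f = mor UNIV A"
    using assms(1) by (auto simp: good_reduction_iff)
  have "mor UNIV rep_one = mor UNIV (rep_map res A)"
    using assms(2) A by (simp add: reduction_mor F.mor_one)
  then obtain \<gamma> where \<gamma>: "\<gamma> \<noteq> 0" "rep_map res A = rep_scale \<gamma> rep_one"
    using A F.rep_one_mem red.rep_map_mem by (auto simp: F.mor_eq_iff P1_rel_UNIV_iff)
  have "fst A = 1"
    using arg_cong[OF \<gamma>(2), of fst] by (simp add: rep_one_def)
  then obtain a b c d where Aeq: "A = (1, [:b, a:], [:d, c:])"
    using rep_degree_1_cases[OF A(1)] by metis
  have mem: "a \<in> val_ring v" "b \<in> val_ring v" "c \<in> val_ring v" "d \<in> val_ring v"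
  proof -
    have "coeff [:b, a:] i \<in> val_ring v" "coeff [:d, c:] i \<in> val_ring v" for i
      using A(1) by (auto simp: Aeq P1_reps_def poly_over_def)
    from this[of 0] this[of 1] show "a \<in> val_ring v" "b \<in> val_ring v" "c \<in> val_ring v" "d \<in> val_ring v"
      by simp_all
  qed
  have "map_poly res [:b, a:] = smult \<gamma> [:0, 1:]" "map_poly res [:d, c:] = smult \<gamma> 1"
    using \<gamma>(2) by (simp_all add: Aeq rep_map_def rep_scale_def rep_one_def)
  then have "coeff (map_poly res [:b, a:]) i = coeff (smult \<gamma> [:0, 1:]) i"
    "coeff (map_poly res [:d, c:]) i = coeff (smult \<gamma> 1) i" for i
    by simp_all
  from this[of 0] this[of 1] have "res a = \<gamma>" "res d = \<gamma>" "res b = 0" "res c = 0"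
    by (simp_all add: coeff_map_poly)
  then show thesis
    using that A mem \<gamma>(1) unfolding Aeq by blast
qed

lemma scalar_imp_one:
  assumes "(1, [:b, a:], [:d, c:]) \<in> P1_reps (val_ring v)" "b = 0" "c = 0" "a = d"
  shows "mor UNIV (1, [:b, a:], [:d, c:]) = \<one>\<^bsub>P1_End UNIV\<^esub>"
proof -
  have "(1, [:b, a:], [:d, c:]) = rep_scale a rep_one"
    using assms by (simp add: rep_scale_def rep_one_def)
  then show ?thesis
    using mor_rep_scale_one generic_fiber[OF assms(1)] by metis
qed

end

text \<open>An endomorphism of degree at least 2 with good reduction, presented by an integral representative.\<close>

locale good_endo = residue v res for v :: "'k::field \<Rightarrow> real" and res :: "'k \<Rightarrow> 'f::field" +
  fixes \<Phi> :: "nat \<times> 'k poly \<times> 'k poly"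
  assumes \<Phi>: "\<Phi> \<in> P1_reps (val_ring v)" and degree: "fst \<Phi> \<ge> 2"
begin

abbreviation Aut where "Aut \<equiv> P1_Aut UNIV (mor UNIV \<Phi>)"
abbreviation AutF where "AutF \<equiv> P1_Aut UNIV (reduction v res (mor UNIV \<Phi>))"

lemma \<phi>_carrier: "mor UNIV \<Phi> \<in> carrier (P1_End UNIV)"
  by (intro K.mor_carrier generic_fiber \<Phi>)

lemma \<phi>_good: "good_reduction v (mor UNIV \<Phi>)"
  using \<Phi> by (auto simp: good_reduction_iff)

sublocale E: monoid "P1_End (UNIV :: 'k set)"
  by (rule K.monoid_P1_End)

sublocale G: group Aut
  by (rule group_P1_Aut[OF \<phi>_carrier])

sublocale GF: group AutF
  by (intro group_P1_Aut reduction_carrier \<phi>_good)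

lemma good_reduction_Aut': "f \<in> carrier Aut \<Longrightarrow> good_reduction v f"
  by (rule good_reduction_Aut[OF \<Phi> degree])

lemma reduction_closed:
  assumes "f \<in> carrier Aut"
  shows "reduction v res f \<in> carrier AutF"
proof -
  let ?g = "inv\<^bsub>P1_End UNIV\<^esub> f"
  have f: "f \<in> Units (P1_End UNIV)"
    and comm: "f \<otimes>\<^bsub>P1_End UNIV\<^esub> mor UNIV \<Phi> = mor UNIV \<Phi> \<otimes>\<^bsub>P1_End UNIV\<^esub> f"
    using assms by (auto simp: P1_Aut_iff[OF \<phi>_carrier])
  have good: "good_reduction v f" "good_reduction v ?g"
    using assms group_P1_Aut(2)[OF \<phi>_carrier] good_reduction_Aut' by blast+
  have "reduction v res f \<otimes>\<^bsub>P1_End UNIV\<^esub> reduction v res ?g = \<one>\<^bsub>P1_End UNIV\<^esub>"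
    "reduction v res ?g \<otimes>\<^bsub>P1_End UNIV\<^esub> reduction v res f = \<one>\<^bsub>P1_End UNIV\<^esub>"
    using f by (simp_all add: reduction_mult[symmetric] good reduction_one)
  then have "reduction v res f \<in> Units (P1_End UNIV)"
    using good reduction_carrier unfolding Units_def by blast
  moreover have "reduction v res f \<otimes>\<^bsub>P1_End UNIV\<^esub> reduction v res (mor UNIV \<Phi>) =
      reduction v res (mor UNIV \<Phi>) \<otimes>\<^bsub>P1_End UNIV\<^esub> reduction v res f"
    by (simp add: reduction_mult[symmetric] good \<phi>_good comm)
  ultimately show ?thesis
    by (simp add: P1_Aut_iff reduction_carrier \<phi>_good)
qed

sublocale red_hom: group_hom Aut AutF "reduction v res"
  by unfold_locales (auto simp: hom_def reduction_closed reduction_mult good_reduction_Aut')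

lemma pow_rep:
  assumes "A \<in> P1_reps UNIV" "mor UNIV A \<in> carrier Aut"
  shows "mor UNIV A [^]\<^bsub>Aut\<^esub> m = mor UNIV (rep_pow A m)"
proof (induction m)
  case 0
  show ?case
    by (simp add: rep_pow_def K.mor_one)
next
  case (Suc m)
  then show ?case
    using G.nat_pow_Suc2[OF assms(2), of m] K.mor_comp[OF assms(1) K.rep_pow_mem[OF assms(1), of m]]
    by (simp add: rep_pow_def)
qed

lemma kernel_iff:
  "f \<in> kernel Aut AutF (reduction v res) \<longleftrightarrow> f \<in> carrier Aut \<and> reduction v res f = \<one>\<^bsub>P1_End UNIV\<^esub>"
  by (simp add: kernel_def)

text \<open>With \<open>f\<close> given by \<open>A\<close>, the coefficient \<open>s\<close> in \<open>A^m = s A + t\<close> is nonzero already modulo the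
  maximal ideal, so \<open>A^m\<close> can be scalar only if \<open>A\<close> is.\<close>

lemma kernel_torsion_trivial:
  assumes f: "f \<in> kernel Aut AutF (reduction v res)"
    and pow: "f [^]\<^bsub>Aut\<^esub> m = \<one>\<^bsub>Aut\<^esub>" and m: "of_nat m \<noteq> (0 :: 'f)"
  shows "f = \<one>\<^bsub>Aut\<^esub>"
proof -
  have fc: "f \<in> carrier Aut" and red: "reduction v res f = \<one>\<^bsub>P1_End UNIV\<^esub>"
    using f by (auto simp: kernel_iff)
  obtain a b c d \<gamma> where A: "(1, [:b, a:], [:d, c:]) \<in> P1_reps (val_ring v)"
    "f = mor UNIV (1, [:b, a:], [:d, c:])" and mem: "a \<in> val_ring v" "b \<in> val_ring v"
    "c \<in> val_ring v" "d \<in> val_ring v"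
    and res: "res a = \<gamma>" "res d = \<gamma>" "res b = 0" "res c = 0" "\<gamma> \<noteq> 0"
    using trivial_reduction_rep[OF good_reduction_Aut'[OF fc] red] by metis
  let ?A = "(1, [:b, a:], [:d, c:]) :: nat \<times> 'k poly \<times> 'k poly"
  define s t where "s = fst (cayley (a + d) (a * d - b * c) m)"
    and "t = snd (cayley (a + d) (a * d - b * c) m)"
  obtain n where n: "m = Suc n"
    using m by (cases m) auto
  have "a * d - b * c = a * d + - (b * c)"
    by simp
  then have "a * d - b * c \<in> val_ring v" "res (a * d - b * c) = \<gamma> * \<gamma>"
    using mem res
    by (simp_all only: O.add_mem O.mult_mem res_uminus red.hom_add red.hom_mult) simp
  then have "res s = of_nat m * \<gamma> ^ n"
    unfolding s_def n using mem res res_cayley[of "a + d" "a * d - b * c" \<gamma> n]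
    by (simp add: O.add_mem red.hom_add)
  then have "s \<noteq> 0"
    using m res(5) by auto
  have "mor UNIV (rep_pow ?A m) = mor UNIV rep_one"
    using pow pow_rep[OF generic_fiber[OF A(1)], of m] fc A(2) by (simp add: K.mor_one)
  then obtain u where "rep_pow ?A m = rep_scale u rep_one"
    using K.mor_eq_iff[OF K.rep_one_mem K.rep_pow_mem[OF generic_fiber[OF A(1)]], of m]
    by (auto simp only: P1_rel_UNIV_iff)
  then have "s * b = 0" "s * c = 0" "s * a + t = s * d + t"
    unfolding rep_pow_cayley s_def[symmetric] t_def[symmetric] rep_lin_scalar_iff by simp_all
  then show ?thesis
    using \<open>s \<noteq> 0\<close> scalar_imp_one[OF A(1)] A(2) by simp
qed

text \<open>Over an infinite field every commuting automorphism has finite order. Over a finite field the absolute value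
  is trivial, and then already \<open>f\<close> itself is trivial.\<close>

lemma kernel_finite_order:
  assumes f: "f \<in> kernel Aut AutF (reduction v res)"
  shows "\<exists>m::nat>0. f [^]\<^bsub>Aut\<^esub> m = \<one>\<^bsub>Aut\<^esub>"
proof (cases "finite (UNIV :: 'k set)")
  case True
  have fc: "f \<in> carrier Aut" and red: "reduction v res f = \<one>\<^bsub>P1_End UNIV\<^esub>"
    using f by (auto simp: kernel_iff)
  obtain a b c d \<gamma> where A: "(1, [:b, a:], [:d, c:]) \<in> P1_reps (val_ring v)"
    "f = mor UNIV (1, [:b, a:], [:d, c:])" and mem: "a \<in> val_ring v" "b \<in> val_ring v"
    "c \<in> val_ring v" "d \<in> val_ring v"
    and res: "res a = \<gamma>" "res d = \<gamma>" "res b = 0" "res c = 0"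
    using trivial_reduction_rep[OF good_reduction_Aut'[OF fc] red] by metis
  have small: "x = 0" if "x \<in> val_ring v" "res x = 0" for x
    using v_trivial_if_finite[OF True, of x] res_eq_0_iff[OF that(1)] that(2) by auto
  have "a + - d = 0"
    using mem res by (intro small) (simp_all only: O.add_mem res_uminus red.hom_add, simp)
  then have "f = \<one>\<^bsub>Aut\<^esub>"
    using scalar_imp_one[OF A(1)] A(2) small[of b] small[of c] mem res
    by (simp add: eq_neg_iff_add_eq_0[symmetric])
  then show ?thesis
    by (metis G.nat_pow_one zero_less_one)
next
  case False
  have fc: "f \<in> carrier Aut"
    using f by (simp add: kernel_iff)
  obtain A B c where A: "A \<in> P1_reps UNIV" "B \<in> P1_reps UNIV" "fst A = 1" "fst B = 1"
    "f = mor UNIV A" "rep_comp B A = rep_one" "rep_comp \<Phi> A = rep_scale c (rep_comp A \<Phi>)"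
    using P1_Aut_rep[OF generic_fiber[OF \<Phi>] fc] by metis
  obtain m u where m: "m > 0" "rep_pow A m = rep_scale u rep_one"
    using commuting_imp_finite_order[OF generic_fiber[OF \<Phi>] degree A(1,3,2,4,6,7) False] by blast
  have "f [^]\<^bsub>Aut\<^esub> m = mor UNIV (rep_scale u rep_one)"
    using pow_rep[OF A(1), of m] fc A(5) m(2) by simp
  also have "\<dots> = \<one>\<^bsub>Aut\<^esub>"
    using mor_rep_scale_one K.rep_pow_mem[OF A(1), of m] m(2) by simp
  finally show ?thesis
    using m(1) by blast
qed

lemma kernel_p_group:
  assumes p: "CHAR('f) > 0"
  shows "p_group CHAR('f) (Aut\<lparr>carrier := kernel Aut AutF (reduction v res)\<rparr>)"
proof -
  let ?N = "kernel Aut AutF (reduction v res)"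
  interpret K: group "Aut\<lparr>carrier := ?N\<rparr>"
    by (intro G.subgroup_imp_group red_hom.subgroup_kernel)
  have pow: "x [^]\<^bsub>Aut\<lparr>carrier := ?N\<rparr>\<^esub> (n :: nat) = x [^]\<^bsub>Aut\<^esub> n" for x n
    by (rule G.nat_pow_consistent[symmetric])
  have "\<exists>n. K.ord f = CHAR('f) ^ n" if f: "f \<in> ?N" for f
  proof -
    have prime: "prime CHAR('f)"
      using p by (rule prime_CHAR_semidom)
    obtain m :: nat where m: "m > 0" "f [^]\<^bsub>Aut\<^esub> m = \<one>\<^bsub>Aut\<^esub>"
      using kernel_finite_order[OF f] by blast
    then have "K.ord f dvd m"
      using f K.pow_eq_id[of f m] by (simp add: pow)
    then have "K.ord f \<noteq> 0"
      using m(1) by auto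
    moreover have "\<not> is_unit CHAR('f)"
      using prime not_prime_unit by blast
    ultimately obtain n q where q: "K.ord f = CHAR('f) ^ n * q" "\<not> CHAR('f) dvd q"
      using multiplicity_decompose'[of "K.ord f" "CHAR('f)"] by blast
    let ?g = "f [^]\<^bsub>Aut\<lparr>carrier := ?N\<rparr>\<^esub> (CHAR('f) ^ n)"
    have "?g [^]\<^bsub>Aut\<lparr>carrier := ?N\<rparr>\<^esub> q = f [^]\<^bsub>Aut\<lparr>carrier := ?N\<rparr>\<^esub> K.ord f"
      unfolding q(1) using f by (intro K.nat_pow_pow) simp
    also have "\<dots> = \<one>\<^bsub>Aut\<lparr>carrier := ?N\<rparr>\<^esub>"
      using f by (intro K.pow_ord_eq_1) simp
    finally have "?g [^]\<^bsub>Aut\<^esub> q = \<one>\<^bsub>Aut\<^esub>"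
      by (simp add: pow)
    moreover have "?g \<in> ?N"
      using f K.nat_pow_closed[of f] by simp
    moreover have "of_nat q \<noteq> (0 :: 'f)"
      using q(2) by (simp add: of_nat_eq_0_iff_char_dvd)
    ultimately have "?g = \<one>\<^bsub>Aut\<^esub>"
      using kernel_torsion_trivial[of ?g q] by (simp add: pow)
    then have "K.ord f dvd CHAR('f) ^ n"
      using f K.pow_eq_id[of f "CHAR('f) ^ n"] by simp
    then show ?thesis
      using prime by (auto simp: divides_primepow_nat)
  qed
  then show ?thesis
    using K.is_group by (simp add: p_group_def)
qed

lemma kernel_trivial:
  assumes "CHAR('f) = 0"
  shows "kernel Aut AutF (reduction v res) = {\<one>\<^bsub>Aut\<^esub>}"
proof (intro equalityI subsetI)
  fix f assume f: "f \<in> kernel Aut AutF (reduction v res)"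
  obtain m :: nat where m: "m > 0" "f [^]\<^bsub>Aut\<^esub> m = \<one>\<^bsub>Aut\<^esub>"
    using kernel_finite_order[OF f] by blast
  have "of_nat m \<noteq> (0 :: 'f)"
    using m(1) assms by (simp add: of_nat_eq_0_iff_char_dvd)
  then have "f = \<one>\<^bsub>Aut\<^esub>"
    by (rule kernel_torsion_trivial[OF f m(2)])
  then show "f \<in> {\<one>\<^bsub>Aut\<^esub>}"
    by (simp only: singleton_iff)
next
  fix f assume "f \<in> {\<one>\<^bsub>Aut\<^esub>}"
  then show "f \<in> kernel Aut AutF (reduction v res)"
    using subgroup.one_closed[OF red_hom.subgroup_kernel] by (simp only: singleton_iff)
qed

end

text \<open>Scaling does not change the degree component, so the description of \<open>rat_degree\<close> picks the one degree
  that occurs in the class \<open>rat_mor\<close>.\<close>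

lemma rat_degree_rep:
  assumes r: "r \<in> P1_reps UNIV" and "rat_mor \<phi> = mor UNIV r"
  shows "rat_degree \<phi> = fst r"
proof -
  have mem: "(\<exists>f g. coprime f g \<and> g \<noteq> 0 \<and> \<phi> = Fract f g \<and> d = max (degree f) (degree g)) \<longleftrightarrow>
      (\<exists>s\<in>mor UNIV r. fst s = d)" for d
    unfolding assms(2)[symmetric] rat_mor_def by force
  have "(\<exists>s\<in>mor UNIV r. fst s = d) \<longleftrightarrow> d = fst r" for d
  proof
    show "d = fst r" if "\<exists>s\<in>mor UNIV r. fst s = d"
      using that by (auto simp only: P1_rel_UNIV_iff Image_singleton_iff fst_rep_scale)
    show "\<exists>s\<in>mor UNIV r. fst s = d" if "d = fst r"
      using coeff_ring.mor_self[OF coeff_ring_UNIV r] that by blast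
  qed
  then show ?thesis
    by (simp add: rat_degree_def mem)
qed

theorem mainTheorem1:
  fixes v :: "'k::field \<Rightarrow> real"
    and res :: "'k \<Rightarrow> 'f::field"
    and \<phi> :: "'k poly fract"
  assumes "nonarch_abs v"
    and "residue_map v res"
    and "rat_degree \<phi> \<ge> 2"
    and "good_reduction v (rat_mor \<phi>)"
  shows "let Autk = P1_Aut UNIV (rat_mor \<phi>);
        AutF = P1_Aut UNIV (reduction v res (rat_mor \<phi>))
    in
    (\<forall>f\<in>carrier Autk. good_reduction v f) \<and>
    group_hom Autk AutF (reduction v res) \<and>
    (CHAR('f) > 0 \<longrightarrow>
       p_group CHAR('f) (Autk\<lparr>carrier := kernel Autk AutF (reduction v res)\<rparr>)) \<and>
    (CHAR('f) = 0 \<longrightarrow> kernel Autk AutF (reduction v res) = {\<one>\<^bsub>Autk\<^esub>})"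
proof -
  interpret R: residue v res
    using assms(1,2) by unfold_locales
  obtain \<Phi> where model: "\<Phi> \<in> P1_reps (val_ring v)" "rat_mor \<phi> = mor UNIV \<Phi>"
    using assms(4) by (auto simp: R.good_reduction_iff)
  have "fst \<Phi> \<ge> 2"
    using assms(3) rat_degree_rep[OF R.generic_fiber[OF model(1)] model(2)] by simp
  then interpret good_endo v res \<Phi>
    using model(1) by unfold_locales
  show ?thesis
    unfolding model(2) Let_def
    by (intro conjI ballI impI good_reduction_Aut' red_hom.group_hom_axioms kernel_p_group
        kernel_trivial)
qed

end
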